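(* Let $g\in L^1(\mathbb{R})$ with $g\ge 0$ and let $I\subset\mathbb{R}$ be compact. Let $C_4>0$ be the smallest constant such that the inequality $$\min_{t\in[0,1]}\int_{\mathbb{R}}f(x)f(t+x)\,dx\leq C_4\|f\|_1^{2}$$ holds for every $f\in L^{1}(\mathbb{R})\cap\mathcal{L}_g(I)$. Let $y_0$ be the smallest positive number in the set $\{y\in\mathbb{R} : y=\tan(y)\}$ and define $$\theta_0:=-\frac{\sin(y_0)}{y_0}=0.217\dots$$ Then $C_4$ is strictly smaller than $\frac{1}{2(1+\theta_0)}$.
   Context: For $g\in L^1(\mathbb{R})$, $g\ge 0$, and $I\subset\mathbb{R}$ compact, $\mathcal{L}_g(I)$ denotes the class of nonnegative functions $f\in L^1(\mathbb{R})$ such that $f\le g$ (almost everywhere) outside $I$. For $f\in L^1(\mathbb{R})$ the autocorrelation $t\mapsto\int_{\mathbb{R}}f(x)f(x+t)\,dx$ is defined for almost every $t$, and the minimum over $t\in[0,1]$ is understood as the essential infimum. $\|f\|_1$ denotes the $L^1(\mathbb{R})$ norm. *)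

theory Defs
  imports "HOL-Analysis.Analysis"
begin

text \<open>
  Elements of L1 of the real line are represented by functions that are Borel and Lebesgue
  integrable (every class contains a Borel representative). All notions below depend only on
  the class: nonnegativity and domination are required almost everywhere.
\<close>

definition dominated_class :: "(real \<Rightarrow> real) \<Rightarrow> real set \<Rightarrow> (real \<Rightarrow> real) set" where
  "dominated_class g I =
     {f. integrable lborel f \<and> (AE x in lborel. 0 \<le> f x) \<and>
         (AE x in lborel. x \<notin> I \<longrightarrow> f x \<le> g x)}"

definition L1_norm :: "(real \<Rightarrow> real) \<Rightarrow> real" where
  "L1_norm f = (\<integral>x. \<bar>f x\<bar> \<partial>lborel)"

text \<open>
  For integrable \<open>f\<close> the integrand below is integrable for almost every \<open>t\<close>; on the remaining
  null set the value is the default \<open>0\<close>, which the essential infimum ignores.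
\<close>

definition autocorrelation :: "(real \<Rightarrow> real) \<Rightarrow> real \<Rightarrow> real" where
  "autocorrelation f t = (\<integral>x. f x * f (x + t) \<partial>lborel)"

text \<open>Dual to \<^term>\<open>Limsup (ae_filter M) f\<close>, the essential supremum.\<close>

definition essinf :: "'a measure \<Rightarrow> ('a \<Rightarrow> 'b::complete_lattice) \<Rightarrow> 'b" where
  "essinf M f = Liminf (ae_filter M) f"

definition autocorrelation_bound :: "(real \<Rightarrow> real) \<Rightarrow> real set \<Rightarrow> real \<Rightarrow> bool" where
  "autocorrelation_bound g I C \<longleftrightarrow>
     (\<forall>f \<in> dominated_class g I.
        essinf (restrict_space lborel {0..1}) (\<lambda>t. ereal (autocorrelation f t))
          \<le> ereal (C * (L1_norm f)\<^sup>2))"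

text \<open>
  The least constant exists: \<open>C = 1\<close> is admissible by Fubini, and the admissible constants form
  an intersection of closed upward half-lines. The value is positive except in degenerate cases
  (such as \<open>g = 0\<close> with \<open>I\<close> contained in a short interval), where there is no least positive
  constant; these are covered with the value \<open>0\<close>.
\<close>

definition best_constant :: "(real \<Rightarrow> real) \<Rightarrow> real set \<Rightarrow> real" where
  "best_constant g I = (LEAST C. 0 \<le> C \<and> autocorrelation_bound g I C)"

definition y0 :: real where
  "y0 = (LEAST y. 0 < y \<and> y = tan y)"

definition theta0 :: real where
  "theta0 = - (sin y0 / y0)"

end

theory Submission
  imports Defs "HOL-Probability.Probability"
begin

text \<open>
  Let \<open>f \<ge> 0\<close> have integral 1 and autocorrelation \<open>A \<ge> m\<close> on \<open>[-1,1]\<close>. Since \<open>sin y0 / y0 = - theta0\<close>,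
  the nonnegativity of \<open>|f^(y0)|\<^sup>2 = \<integral> A(t) cos (y0 t) dt\<close> gives \<open>\<eta> = 1 - 2 m (1 + theta0) \<ge> 0\<close>,
  which is the bound with \<open>\<le>\<close>. Suppose that \<open>\<eta>\<close> is tiny. Then \<open>f^(y0)\<close> is tiny, and the part of \<open>A\<close>
  in excess of \<open>m\<close> on \<open>[-1,1]\<close>, of mass about \<open>c\<^sup>2 = theta0 / (1 + theta0)\<close>, sits near multiples of
  the period \<open>2 pi / y0\<close>. Modulo this period the autocorrelation is therefore almost a point mass \<open>c\<^sup>2\<close> at
  \<open>0\<close> plus a bounded density, so \<open>f\<close> itself has one cluster of mass about \<open>c\<close>: two clusters would
  produce a peak of \<open>A\<close> at their distance. As \<open>f^(y0)\<close> almost vanishes, the rest of the mass must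
  balance the cluster, but the density bound \<open>m\<close> on \<open>[-1,1]\<close> limits the interaction of the two parts
  at the distances where \<open>cos (y0 t) < - theta0\<close>. This forces \<open>1 - c \<le> pi / (y0 (1 + theta0))\<close> up to
  a small error, which is false.
\<close>

section \<open>The number \<open>y0\<close>, the constant \<open>theta0\<close> and numerical
  bounds\<close>

text \<open>The intermediate value theorem applies to \<open>sin y - y * cos y\<close>, which is
  \<open>pi\<close> at \<open>pi\<close> and -1 at \<open>3 * pi / 2\<close>. At a zero
  \<open>cos\<close> cannot vanish, since \<open>sin\<close> would vanish too, so the zero is a
  fixed point of \<open>tan\<close>.\<close>

lemma fixpoint_tan_exists:
  "\<exists>y. pi < y \<and> y < 3 * pi / 2 \<and> y = tan y"
proof -
  define h where "h = (\<lambda>y::real. sin y - y * cos y)"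
  have "\<exists>y\<ge>pi. y \<le> 3 * pi / 2 \<and> h y = 0"
  proof (rule IVT2)
    have "sin (3 * pi / 2) = -1" "cos (3 * pi / 2) = 0"
      using sin_add[of pi "pi/2"] cos_add[of pi "pi/2"] by (simp_all add: field_simps)
    then show "h (3 * pi / 2) \<le> 0" by (simp add: h_def)
  qed (auto simp: h_def intro!: continuous_intros)
  then obtain y where y: "pi \<le> y" "y \<le> 3 * pi / 2" "h y = 0" by auto
  have "cos y \<noteq> 0"
  proof
    assume "cos y = 0"
    with y(3) have "sin y = 0" by (simp add: h_def)
    with \<open>cos y = 0\<close> sin_cos_squared_add[of y] show False by simp
  qed
  moreover have "cos (3 * pi / 2) = 0"
    using cos_add[of pi "pi/2"] by (simp add: field_simps)
  ultimately have "y \<noteq> 3 * pi / 2" by metis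
  moreover have "y \<noteq> pi" using y(3) by (auto simp: h_def)
  moreover have "y = tan y"
    using y(3) \<open>cos y \<noteq> 0\<close> by (simp add: h_def tan_def field_simps)
  ultimately show ?thesis using y by force
qed

text \<open>On \<open>(0, pi / 2)\<close> the derivative of \<open>tan\<close> exceeds 1, so
  \<open>tan y > y\<close>; on \<open>(pi / 2, pi)\<close> the tangent is negative.\<close>

lemma fixpoint_tan_gt_pi:
  fixes y :: real
  assumes "0 < y" "y = tan y"
  shows "pi < y"
proof (rule ccontr)
  assume "\<not> pi < y"
  consider "y < pi / 2" | "y = pi / 2" | "pi / 2 < y" "y < pi" | "y = pi"
    using \<open>\<not> pi < y\<close> by linarith
  then show False
  proof cases
    case 1
    have "y < tan y"
    proof -
      have "\<exists>z>0. z < y \<and> tan y - tan 0 = (y - 0) * inverse ((cos z)\<^sup>2)"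
      proof (rule MVT2)
        fix x assume "0 \<le> x" "x \<le> y"
        then have "cos x \<noteq> 0" using 1 cos_gt_zero_pi[of x] by auto
        then show "(tan has_real_derivative inverse ((cos x)\<^sup>2)) (at x)"
          by (rule DERIV_tan)
      qed (use assms in auto)
      then obtain z where z: "0 < z" "z < y" "tan y = y * inverse ((cos z)\<^sup>2)" by auto
      have "0 < cos z" using z 1 cos_gt_zero_pi[of z] by auto
      moreover have "cos z < 1" using cos_monotone_0_pi[of 0 z] z 1 by auto
      ultimately have "(cos z)\<^sup>2 < 1" "0 < (cos z)\<^sup>2"
        by (auto simp: power_less_one_iff abs_square_less_1)
      then have "1 < inverse ((cos z)\<^sup>2)" by (simp add: one_less_inverse)
      then show ?thesis using z assms by simp
    qed
    then show False using assms by simp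
  next
    case 2
    \<comment> \<open>Division by zero yields 0, so \<open>tan (pi / 2)\<close> is 0.\<close>
    then have "tan y = 0" by (simp only: tan_def cos_pi_half) simp
    then show False using assms by simp
  next
    case 3
    have "tan y = tan (y - pi)" by (simp add: tan_def)
    also have "\<dots> < 0" using 3 by (intro tan_less_zero) auto
    finally show False using assms by simp
  next
    case 4
    then show False using assms by simp
  qed
qed

text \<open>With \<open>v = 3 * pi / 2 - y\<close> the equation reads \<open>y = cot v\<close>, and
  \<open>v * cot v \<le> 1\<close> on \<open>(0, pi / 2)\<close>. The resulting quadratic condition
  gives an explicit lower bound for \<open>y\<close>.\<close>

lemma fixpoint_tan_quadratic:
  fixes y :: real
  assumes "pi < y" "y < 3 * pi / 2" "y = tan y"
  shows "y * (3 * pi / 2 - y) \<le> 1"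
proof -
  define v where v_def: "v = 3 * pi / 2 - y"
  have v: "0 < v" "v < pi / 2" using assms by (auto simp: v_def)
  have "sin v = - cos y" "cos v = - sin y"
  proof -
    have veq: "v = (pi / 2 - y) + pi" by (simp add: v_def)
    show "sin v = - cos y" "cos v = - sin y" unfolding veq sin_periodic_pi cos_periodic_pi by (simp_all add: sin_diff cos_diff)
  qed
  then have "tan y = cos v / sin v" by (simp add: tan_def)
  moreover have "0 < sin v" using v sin_gt_zero[of v] by auto
  ultimately have yv: "y * sin v = cos v" using assms by (simp add: field_simps)
  have "v * cos v \<le> sin v"
  proof -
    have "\<exists>z>0. z < v \<and> (sin v - v * cos v) - (sin 0 - 0 * cos 0) = (v - 0) * (z * sin z)"
      by (rule MVT2) (use v in \<open>auto intro!: derivative_eq_intros\<close>)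
    then obtain z where "0 < z" "z < v" "sin v - v * cos v = v * (z * sin z)" by auto
    moreover have "0 \<le> sin z" using \<open>0 < z\<close> \<open>z < v\<close> v by (intro sin_ge_zero) auto
    ultimately show ?thesis using v by (smt (verit) mult_nonneg_nonneg)
  qed
  then have "y * v * sin v \<le> sin v" using yv by (simp add: algebra_simps)
  then show ?thesis using \<open>0 < sin v\<close> by (simp add: v_def)
qed

lemma fixpoint_tan_lower:
  fixes y :: real
  assumes "pi < y" "y < 3 * pi / 2" "y = tan y"
  shows "448 / 100 \<le> y"
proof (rule ccontr)
  assume lt: "\<not> 448 / 100 \<le> y"
  have pi3: "3 \<le> pi" "4712 / 1000 \<le> 3 * pi / 2" using pi_approx by simp_all
  \<comment> \<open>On \<open>[3, 448/100]\<close> the square \<open>y * y\<close> lies below its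
    chord, which makes the quadratic condition linear.\<close>
  have "0 \<le> (y - 3) * (448/100 - y)"
    using assms lt pi3 by (intro mult_nonneg_nonneg) linarith+
  moreover have "(y - 3) * (448/100 - y) = (748/100) * y - 3 * (448/100) - y * y" by (simp add: field_simps)
  moreover have "y * (4712/1000) \<le> y * (3 * pi / 2)"
    using assms pi3 by (intro mult_left_mono) linarith+
  moreover have "y * (3 * pi / 2) - y * y \<le> 1"
    using fixpoint_tan_quadratic[OF assms] by (simp add: algebra_simps)
  ultimately show False using lt by linarith
qed

text \<open>The function \<open>sin y - y * cos y\<close> has derivative \<open>y * sin y\<close>,
  which is negative on this interval, so it has at most one zero there.\<close>

lemma fixpoint_tan_unique:
  fixes x y :: real
  assumes "pi < x" "x < y" "y < 3 * pi / 2" "x = tan x"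
  shows "y \<noteq> tan y"
proof -
  have cos_neg: "cos z < 0" if "pi < z" "z < 3 * pi / 2" for z :: real
  proof -
    have "0 < cos (z - pi)" using that by (intro cos_gt_zero_pi) auto
    then show ?thesis by simp
  qed
  have "\<exists>z>x. z < y \<and> (sin y - y * cos y) - (sin x - x * cos x) = (y - x) * (z * sin z)"
    by (rule MVT2) (use assms in \<open>auto intro!: derivative_eq_intros\<close>)
  then obtain z where z: "x < z" "z < y"
      "(sin y - y * cos y) - (sin x - x * cos x) = (y - x) * (z * sin z)"
    by auto
  have "0 < sin (z - pi)" using z assms by (intro sin_gt_zero) auto
  then have "sin z < 0" by simp
  then have "(y - x) * (z * sin z) < 0"
    using z assms pi_gt_zero by (intro mult_pos_neg mult_pos_neg) linarith+
  moreover have "cos x \<noteq> 0" "cos y \<noteq> 0" using cos_neg[of x] cos_neg[of y] assms by auto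
  moreover have "sin x - x * cos x = 0"
    using assms(4) \<open>cos x \<noteq> 0\<close> by (simp add: tan_def field_simps)
  ultimately show ?thesis using z by (auto simp: tan_def field_simps)
qed

text \<open>\<open>LEAST\<close> over the reals is informative only once a minimum is exhibited: the
  fixed point found above is minimal, because none lies in \<open>(0, pi]\<close> and at most one in
  \<open>(pi, 3 * pi / 2)\<close>.\<close>

lemma y0_props: "pi < y0" "y0 < 3 * pi / 2" "y0 = tan y0"
proof -
  obtain y where y: "pi < y" "y < 3 * pi / 2" "y = tan y" using fixpoint_tan_exists by auto
  have "y0 = y" unfolding y0_def
  proof (rule Least_equality)
    show "0 < y \<and> y = tan y" using y pi_gt_zero by linarith
    fix x :: real assume x: "0 < x \<and> x = tan x"
    then have "pi < x" using fixpoint_tan_gt_pi by blast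
    then show "y \<le> x" using fixpoint_tan_unique[of x y] x y by fastforce
  qed
  then show "pi < y0" "y0 < 3 * pi / 2" "y0 = tan y0" using y by auto
qed

lemma y0_ge: "448 / 100 \<le> y0"
  using fixpoint_tan_lower[OF y0_props] .

lemma y0_le: "y0 \<le> 5"
  using y0_props(2) pi_approx by simp

lemma cos_y0_neg: "cos y0 < 0"
proof -
  have "0 < cos (y0 - pi)" using y0_props by (intro cos_gt_zero_pi) auto
  then show ?thesis by simp
qed

lemma sin_y0: "sin y0 = - theta0 * y0"
  using y0_ge by (simp add: theta0_def)

text \<open>The equation \<open>y = tan y\<close> says that \<open>sin y / y\<close> is stationary;
  it makes \<open>cos y0\<close> equal to \<open>sin y0 / y0\<close>.\<close>

lemma cos_y0: "cos y0 = - theta0"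
proof -
  have "sin y0 = y0 * cos y0" using y0_props(3) cos_y0_neg by (simp add: tan_def field_simps)
  then show ?thesis using y0_ge by (simp add: theta0_def)
qed

lemma theta0_pos: "0 < theta0"
  using cos_y0 cos_y0_neg by simp

text \<open>The Pythagorean identity at \<open>y0\<close> reads
  \<open>theta0\<^sup>2 * (1 + y0\<^sup>2) = 1\<close>, so the lower bound for \<open>y0\<close>
  bounds \<open>theta0\<close> from above.\<close>

lemma theta0_le: "theta0 \<le> 218 / 1000"
proof (rule ccontr)
  assume *: "\<not> theta0 \<le> 218 / 1000"
  have "1 = theta0\<^sup>2 * (1 + y0\<^sup>2)"
    using sin_cos_squared_add[of y0] by (simp add: sin_y0 cos_y0 power_mult_distrib algebra_simps)
  moreover have "(218 / 1000)\<^sup>2 \<le> theta0\<^sup>2" "(448/100)\<^sup>2 \<le> y0\<^sup>2"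
    using * y0_ge by (intro power_mono; simp)+
  then have "(218 / 1000)\<^sup>2 * (1 + (448/100)\<^sup>2) \<le> theta0\<^sup>2 * (1 + y0\<^sup>2)"
    by (intro mult_mono) auto
  ultimately show False by (simp add: power2_eq_square)
qed

text \<open>The margin is narrow: for \<open>c\<^sup>2 = theta0 / (1 + theta0)\<close> the two sides are about 0.5744 and 0.5775.\<close>

lemma atom_mass_bound:
  assumes "0 \<le> c" "c\<^sup>2 = theta0 / (1 + theta0)"
  shows "pi / (y0 * (1 + theta0)) < 1 - c"
proof -
  define th where "th = theta0"
  have th: "0 < th" "th \<le> 218 / 1000" using theta0_pos theta0_le by (auto simp: th_def)
  have csq: "c\<^sup>2 * (1 + th) = th" using assms th by (simp add: th_def[symmetric])
  define q where "q = c * (1 + th)"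
  have q2: "q\<^sup>2 = th * (1 + th)"
    using csq by (simp add: q_def power2_eq_square mult.assoc mult.left_commute)
  have piy: "pi / y0 \<le> 70125 / 100000"
    using y0_ge pi_approx by (simp add: field_simps)
  \<comment> \<open>The constant is \<open>1 - 70125 / 100000\<close>, complementary to the bound on
    \<open>pi / y0\<close>. After squaring, the claim is linear in \<open>th\<close> and holds up to
    about 0.2217.\<close>
  have "q < th + 29875 / 100000"
  proof (rule power2_less_imp_less)
    show "q\<^sup>2 < (th + 29875 / 100000)\<^sup>2"
      unfolding q2 using th by (simp add: power2_eq_square algebra_simps)
  qed (use th in simp)
  with piy have "pi / y0 < 1 + th - q" by linarith
  also have "1 + th - q = (1 - c) * (1 + th)" by (simp add: q_def algebra_simps)
  finally have "pi / y0 / (1 + th) < 1 - c" by (subst pos_divide_less_eq) (use th in auto)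
  then show ?thesis by (simp add: th_def)
qed

section \<open>Chordal distance on the circle\<close>

text \<open>The chord between the images of \<open>x\<close> and \<open>x + t\<close> on the circle \<open>\<real> / (2 pi / y0) \<int>\<close>.\<close>

definition chord :: "real \<Rightarrow> real" where
  "chord t = 2 * \<bar>sin (y0 * t / 2)\<bar>"

lemma chord_measurable [measurable]: "chord \<in> borel_measurable borel"
  unfolding chord_def by measurable

lemma chord_nonneg: "0 \<le> chord t"
  by (simp add: chord_def)

lemma chord_minus: "chord (- t) = chord t"
  by (simp add: chord_def)

lemma chord_diff_commute: "chord (x - y) = chord (y - x)"
  using chord_minus[of "x - y"] by simp

text \<open>Links the metric to the test function \<open>1 - cos (y0 * t)\<close>, so that
  indicators of sets away from the zeros of that function can be dominated by multiples of
  it.\<close>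

lemma chord_square: "(chord t)\<^sup>2 = 2 * (1 - cos (y0 * t))"
  using cos_double_sin[of "y0 * t / 2"] by (simp add: chord_def power_mult_distrib)

lemma chord_add: "chord (s + t) \<le> chord s + chord t"
proof -
  have "\<bar>sin (a + b)\<bar> \<le> \<bar>sin a\<bar> + \<bar>sin b\<bar>" for a b :: real
  proof -
    have "\<bar>sin (a + b)\<bar> \<le> \<bar>sin a * cos b\<bar> + \<bar>cos a * sin b\<bar>"
      unfolding sin_add by (rule abs_triangle_ineq)
    also have "\<dots> \<le> \<bar>sin a\<bar> * 1 + 1 * \<bar>sin b\<bar>"
      unfolding abs_mult by (intro add_mono mult_mono) auto
    finally show ?thesis by simp
  qed
  from this[of "y0 * s / 2" "y0 * t / 2"] show ?thesis
    by (simp add: chord_def algebra_simps add_divide_distrib)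
qed

lemma chord_triangle: "chord (x - z) \<le> chord (x - y) + chord (y - z)"
  using chord_add[of "x - y" "y - z"] by simp

text \<open>Here \<open>x = y0 * \<bar>t\<bar> / 2\<close> is at most 1, below
  \<open>pi / 3\<close>, so \<open>sin x \<ge> x / 2\<close>; the rest is
  \<open>y0 \<ge> 4\<close>.\<close>

lemma chord_ge:
  assumes "\<bar>t\<bar> \<le> 1 / 4"
  shows "2 * \<bar>t\<bar> \<le> chord t"
proof -
  define x where "x = y0 * \<bar>t\<bar> / 2"
  have "y0 * \<bar>t\<bar> \<le> 5 * (1 / 4)"
    using assms y0_le y0_ge by (intro mult_mono) auto
  then have x: "0 \<le> x" "x \<le> 1" using y0_ge by (auto simp: x_def)
  have "x / 2 \<le> sin x"
  proof (cases "x = 0")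
    case False
    have "\<exists>z>0. z < x \<and> sin x - sin 0 = (x - 0) * cos z"
      by (rule MVT2) (use x False in auto)
    then obtain z where z: "0 < z" "z < x" "sin x = x * cos z" by auto
    have "z \<le> pi / 3" using z x pi_ge_two pi_approx by simp
    then have "cos (pi / 3) \<le> cos z" using z by (intro cos_monotone_0_pi_le) auto
    then have "x * (1 / 2) \<le> x * cos z" using x by (intro mult_left_mono) (auto simp: cos_60)
    then show ?thesis using z by simp
  qed simp
  moreover have "\<bar>sin (y0 * t / 2)\<bar> = \<bar>sin x\<bar>"
    by (cases "0 \<le> t") (auto simp: x_def)
  moreover have "4 * \<bar>t\<bar> \<le> y0 * \<bar>t\<bar>" using y0_ge by (intro mult_right_mono) auto
  ultimately show ?thesis by (auto simp: chord_def x_def)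
qed

text \<open>The interval is cut into 8 pieces of length 1/4. On each of them the chord dominates the
  distance, so the set there fits into an interval of length \<open>4 * \<delta>\<close>.\<close>

lemma measure_chord_less:
  assumes "0 \<le> \<delta>"
  shows "measure lborel {t \<in> {-1..1}. chord (t - s) < 2 * \<delta>} \<le> 32 * \<delta>"
proof -
  define T where "T i = {t \<in> {- 1 + real i / 4 .. - 1 + real i / 4 + 1 / 4}. chord (t - s) < 2 * \<delta>}"
    for i :: nat
  have T: "T i \<in> fmeasurable lborel" for i
  proof (rule fmeasurableI2)
    show "{- 1 + real i / 4 .. - 1 + real i / 4 + 1 / 4} \<in> fmeasurable lborel"
      by (intro fmeasurable_compact compact_Icc)
    show "T i \<in> sets lborel" unfolding T_def by measurable
  qed (auto simp: T_def)
  have T_sets: "T i \<in> sets borel" for i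
    unfolding T_def by measurable
  have small: "measure lborel (T i) \<le> 4 * \<delta>" for i
  proof (cases "T i = {}")
    case False
    then obtain t0 where t0: "t0 \<in> T i" by auto
    have "T i \<subseteq> {t0 - 2 * \<delta> .. t0 + 2 * \<delta>}"
    proof
      fix t assume t: "t \<in> T i"
      have "2 * \<bar>t - t0\<bar> \<le> chord (t - t0)"
      proof (rule chord_ge)
        define r where "r = - 1 + real i / 4"
        have "r \<le> t" "t \<le> r + 1 / 4" "r \<le> t0" "t0 \<le> r + 1 / 4"
          using t t0 by (auto simp: T_def r_def)
        then show "\<bar>t - t0\<bar> \<le> 1 / 4" by linarith
      qed
      also have "\<dots> \<le> chord (t - s) + chord (t0 - s)"
        using chord_triangle[of t t0 s] chord_diff_commute[of s t0] by simp
      also have "\<dots> \<le> 4 * \<delta>" using t t0 by (auto simp: T_def)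
      finally show "t \<in> {t0 - 2 * \<delta> .. t0 + 2 * \<delta>}" by auto
    qed
    then have "measure lborel (T i) \<le> measure lborel {t0 - 2 * \<delta> .. t0 + 2 * \<delta>}"
      using T_sets by (intro measure_mono_fmeasurable) (auto intro: fmeasurable_compact)
    then show ?thesis using assms by simp
  qed (use assms in auto)
  have "{t \<in> {-1..1}. chord (t - s) < 2 * \<delta>} \<subseteq> (\<Union>i<8. T i)"
  proof
    fix t assume t: "t \<in> {t \<in> {-1..1}. chord (t - s) < 2 * \<delta>}"
    have "\<exists>i<8. - 1 + real i / 4 \<le> t \<and> t \<le> - 1 + real i / 4 + 1 / 4"
    proof (cases "t = 1")
      case True
      \<comment> \<open>At the right endpoint the floor would give the index 8; the point belongs to
        the last piece instead.\<close>
      then show ?thesis by (intro exI[of _ 7]) auto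
    next
      case False
      then show ?thesis using t
        by (intro exI[of _ "nat \<lfloor>4 * (t + 1)\<rfloor>"]) (auto simp: nat_less_iff floor_less_iff; linarith)
    qed
    then show "t \<in> (\<Union>i<8. T i)" using t by (auto simp: T_def)
  qed
  then have "measure lborel {t \<in> {-1..1}. chord (t - s) < 2 * \<delta>} \<le> measure lborel (\<Union>i<8. T i)"
    using T T_sets by (intro measure_mono_fmeasurable) (auto intro!: fmeasurable.finite_UN)
  also have "\<dots> \<le> (\<Sum>i<8. measure lborel (T i))"
    using T_sets by (intro measure_UNION_le) auto
  also have "\<dots> \<le> (\<Sum>i<(8::nat). 4 * \<delta>)" by (intro sum_mono small)
  finally show ?thesis by simp
qed

section \<open>Integrals of the test functions over \<open>[-1,1]\<close>\<close>

text \<open>The mean of \<open>cos (y0 * t)\<close> over the interval is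
  \<open>sin y0 / y0 = - theta0\<close>. This is the source of the constant
  \<open>1 / (2 * (1 + theta0))\<close>.\<close>

lemma integral_one_minus_cos_y0:
  "(\<integral>t. (1 - cos (y0 * t)) * indicator {-1..1} t \<partial>lborel) = 2 * (1 + theta0)"
proof -
  define F where "F t = t - sin (y0 * t) / y0" for t
  have "(\<integral>t. (1 - cos (y0 * t)) * indicator {-1..1} t \<partial>lborel) = F 1 - F (- 1)"
    using y0_ge unfolding F_def
    by (intro integral_FTC_Icc_real) (auto intro!: derivative_eq_intros)
  also have "\<dots> = 2 * (1 + theta0)" using y0_ge by (simp add: F_def sin_y0)
  finally show ?thesis .
qed

text \<open>Positive exactly at the distances where \<open>cos (y0 * t) < - theta0\<close>; adding
  it to \<open>cos (y0 * t) + theta0\<close> restores nonnegativity.\<close>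

definition dip :: "real \<Rightarrow> real" where
  "dip t = max 0 (- cos (y0 * t) - theta0)"

lemma dip_measurable [measurable]: "dip \<in> borel_measurable borel"
  unfolding dip_def by measurable

lemma dip_nonneg: "0 \<le> dip t"
  by (simp add: dip_def)

lemma dip_le: "dip t \<le> 1 - cos (y0 * t)"
  using theta0_pos cos_le_one[of "y0 * t"] by (auto simp: dip_def)

text \<open>As \<open>cos y0 = - theta0\<close>, the function is supported within
  \<open>[-1,1]\<close> on two intervals reaching exactly to the endpoints, where it has an
  elementary primitive.\<close>

lemma integral_dip_le:
  "(\<integral>t. dip t * indicator {-1..1} t \<partial>lborel) \<le> 4 * pi * theta0 / y0"
proof -
  \<comment> \<open>The mirror image of 1 in \<open>pi / y0\<close>, where
    \<open>cos (y0 * t)\<close> takes the value \<open>cos y0\<close> again.\<close>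
  define b where "b = 2 * pi / y0 - 1"
  have b: "0 < b" "b < 1"
    using y0_props y0_ge pi_approx by (auto simp: b_def field_simps)
  have yb: "y0 * b = 2 * pi - y0" using y0_ge by (simp add: b_def field_simps)
  define k where "k t = - cos (y0 * t) - theta0" for t
  define F where "F t = - sin (y0 * t) / y0 - theta0 * t" for t
  have FTC: "has_bochner_integral lborel (\<lambda>t. k t * indicator {u..v} t) (F v - F u)"
    if "u \<le> v" for u v
    using that y0_ge unfolding k_def F_def
    by (intro has_bochner_integral_FTC_Icc_real) (auto intro!: derivative_eq_intros)
  have "F 1 - F b = 2 * pi * theta0 / y0"
  proof -
    have "sin (y0 * b) = theta0 * y0" by (simp add: yb sin_diff sin_y0)
    then show ?thesis using y0_ge by (simp add: F_def sin_y0 b_def field_simps)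
  qed
  moreover have "F (- b) - F (- 1) = F 1 - F b" by (simp add: F_def)
  ultimately have total: "(F (- b) - F (- 1)) + (F 1 - F b) = 4 * pi * theta0 / y0"
    by simp
  have kneg: "k t \<le> 0" if "\<bar>t\<bar> \<le> b" for t
  proof -
    have "y0 * \<bar>t\<bar> \<le> y0 * b" using that y0_ge by (intro mult_left_mono) auto
    then have "cos (2 * pi - y0) \<le> cos (y0 * \<bar>t\<bar>)"
      using y0_ge y0_props by (intro cos_monotone_0_pi_le) (auto simp: yb)
    moreover have "cos (y0 * \<bar>t\<bar>) = cos (y0 * t)" by (cases "0 \<le> t") auto
    ultimately show ?thesis by (simp add: k_def cos_diff cos_y0)
  qed
  have kpos: "0 \<le> k t" if "b \<le> \<bar>t\<bar>" "\<bar>t\<bar> \<le> 1" for t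
  proof -
    have "y0 * b \<le> y0 * \<bar>t\<bar>" "y0 * \<bar>t\<bar> \<le> y0 * 1"
      using that y0_ge by (intro mult_left_mono; simp)+
    then have "\<bar>y0 * \<bar>t\<bar> - pi\<bar> \<le> y0 - pi" by (auto simp: yb)
    then have "cos (y0 - pi) \<le> cos \<bar>y0 * \<bar>t\<bar> - pi\<bar>"
      using y0_props by (intro cos_monotone_0_pi_le) auto
    then have "theta0 \<le> cos (y0 * \<bar>t\<bar> - pi)" by (simp add: cos_y0)
    moreover have "cos (y0 * \<bar>t\<bar>) = cos (y0 * t)" by (cases "0 \<le> t") auto
    ultimately show ?thesis by (simp add: k_def)
  qed
  have pointwise: "dip t * indicator {-1..1} t
      \<le> k t * indicator {-1..- b} t + k t * indicator {b..1} t" for t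
    using kneg[of t] kpos[of t] b unfolding dip_def k_def[symmetric]
    by (auto simp: indicator_def abs_le_iff)
  have "(\<integral>t. dip t * indicator {-1..1} t \<partial>lborel)
      \<le> (\<integral>t. k t * indicator {-1..- b} t + k t * indicator {b..1} t \<partial>lborel)"
  proof (rule integral_mono_AE')
    show "integrable lborel (\<lambda>t. k t * indicator {-1..- b} t + k t * indicator {b..1} t)"
      using FTC b by (intro Bochner_Integration.integrable_add) (auto simp: has_bochner_integral_iff)
    show "AE t in lborel. 0 \<le> k t * indicator {-1..- b} t + k t * indicator {b..1} t"
      by (rule AE_I2) (rule order_trans[OF _ pointwise], simp add: dip_nonneg)
  qed (simp add: pointwise)
  also have "\<dots> = (F (- b) - F (- 1)) + (F 1 - F b)"
    using FTC b by (subst Bochner_Integration.integral_add) (auto simp: has_bochner_integral_iff)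
  finally show ?thesis using total by simp
qed

section \<open>Probability measures with large autocorrelation\<close>

text \<open>
  If \<^term>\<open>M\<close> has density \<open>f\<close>, then \<open>snd z - fst z\<close> has the autocorrelation of \<open>f\<close> as its density,
  and the last assumption says that this density is at least \<^term>\<open>m\<close> on \<open>[-1,1]\<close>.
\<close>

locale large_autocorrelation = prob_space M for M :: "real measure" +
  fixes m :: real
  assumes sets_M [measurable_cong]: "sets M = sets borel"
    and m_nonneg: "0 \<le> m"
    and autocorrelation_ge: "\<And>\<phi> B. \<phi> \<in> borel_measurable borel \<Longrightarrow> (\<And>t. 0 \<le> \<phi> t) \<Longrightarrow>
      (\<And>t. \<phi> t \<le> B) \<Longrightarrow>
      m * (\<integral>t. \<phi> t * indicator {-1..1} t \<partial>lborel) \<le> (\<integral>z. \<phi> (snd z - fst z) \<partial>(M \<Otimes>\<^sub>M M))"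
begin

text \<open>The slack in \<open>m \<le> 1 / (2 * (1 + theta0))\<close>, rescaled.\<close>

definition \<eta> :: real where
  "\<eta> = 1 - 2 * m * (1 + theta0)"

text \<open>An arc of the circle pulled back to the line, hence periodic with period
  \<open>2 * pi / y0\<close>.\<close>

definition near :: "real \<Rightarrow> real \<Rightarrow> real set" where
  "near a r = {x. chord (x - a) < r}"

lemma near_sets [measurable]: "near a r \<in> sets borel"
  unfolding near_def by measurable

sublocale MM: pair_prob_space M M
  by unfold_locales

lemma space_M: "space M = UNIV"
  using sets_eq_imp_space_eq[OF sets_M] by simp

lemma integrable_bounded:
  fixes f :: "real \<Rightarrow> real"
  assumes "f \<in> borel_measurable borel" "\<And>x. \<bar>f x\<bar> \<le> B"
  shows "integrable M f"
proof (rule integrable_const_bound)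
  show "f \<in> borel_measurable M"
    using assms(1) measurable_cong_sets[OF sets_M refl, of borel] by blast
  show "AE x in M. norm (f x) \<le> B" using assms(2) by (intro AE_I2) simp
qed

lemma integrable_pair_bounded:
  fixes f :: "real \<times> real \<Rightarrow> real"
  assumes "f \<in> borel_measurable (M \<Otimes>\<^sub>M M)" "\<And>z. \<bar>f z\<bar> \<le> B"
  shows "integrable (M \<Otimes>\<^sub>M M) f"
  by (rule MM.P.integrable_const_bound[where B = B]) (simp_all add: assms)

lemma integrable_diff_bounded:
  fixes \<phi> :: "real \<Rightarrow> real"
  assumes [measurable]: "\<phi> \<in> borel_measurable borel" and "\<And>t. \<bar>\<phi> t\<bar> \<le> B"
  shows "integrable (M \<Otimes>\<^sub>M M) (\<lambda>z. \<phi> (snd z - fst z))"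
  by (rule integrable_pair_bounded[where B = B]) (measurable, rule assms(2))

lemma
  fixes g h :: "real \<Rightarrow> real"
  assumes [measurable]: "g \<in> borel_measurable borel" "h \<in> borel_measurable borel"
    and bd: "\<And>x. \<bar>g x\<bar> \<le> 1" "\<And>x. \<bar>h x\<bar> \<le> 1"
  shows integrable_product: "integrable (M \<Otimes>\<^sub>M M) (\<lambda>z. g (fst z) * h (snd z))"
    and integral_product: "(\<integral>z. g (fst z) * h (snd z) \<partial>(M \<Otimes>\<^sub>M M)) = (\<integral>x. g x \<partial>M) * (\<integral>x. h x \<partial>M)"
proof -
  have "\<bar>g (fst z) * h (snd z)\<bar> \<le> 1" for z
    unfolding abs_mult using bd by (intro mult_le_one) auto
  then show int: "integrable (M \<Otimes>\<^sub>M M) (\<lambda>z. g (fst z) * h (snd z))"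
    by (intro integrable_pair_bounded[where B = 1]) measurable
  show "(\<integral>z. g (fst z) * h (snd z) \<partial>(M \<Otimes>\<^sub>M M)) = (\<integral>x. g x \<partial>M) * (\<integral>x. h x \<partial>M)"
    using MM.integral_fst'[OF int] by simp
qed

text \<open>\<open>C\<close> and \<open>S\<close> are the real and imaginary parts of the
  characteristic function of \<open>M\<close> at \<open>y0\<close>.\<close>

definition C :: real where "C = (\<integral>x. cos (y0 * x) \<partial>M)"
definition S :: real where "S = (\<integral>x. sin (y0 * x) \<partial>M)"

lemma cos_diff_expand: "cos (y0 * (y - x)) = cos (y0 * x) * cos (y0 * y) + sin (y0 * x) * sin (y0 * y)"
  by (simp add: right_diff_distrib cos_diff mult.commute)

lemma integral_cos_diff: "(\<integral>z. cos (y0 * (snd z - fst z)) \<partial>(M \<Otimes>\<^sub>M M)) = C\<^sup>2 + S\<^sup>2"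
proof -
  note cos_product = integral_product[of "\<lambda>x. cos (y0 * x)" "\<lambda>x. cos (y0 * x)"]
    integrable_product[of "\<lambda>x. cos (y0 * x)" "\<lambda>x. cos (y0 * x)"]
  note sin_product = integral_product[of "\<lambda>x. sin (y0 * x)" "\<lambda>x. sin (y0 * x)"]
    integrable_product[of "\<lambda>x. sin (y0 * x)" "\<lambda>x. sin (y0 * x)"]
  show ?thesis
    unfolding cos_diff_expand C_def S_def
    using cos_product sin_product by (simp add: power2_eq_square)
qed

lemma integral_one_minus_cos_diff:
  "(\<integral>z. 1 - cos (y0 * (snd z - fst z)) \<partial>(M \<Otimes>\<^sub>M M)) = 1 - (C\<^sup>2 + S\<^sup>2)"
  using integrable_diff_bounded[of "\<lambda>t. cos (y0 * t)" 1]
  by (subst Bochner_Integration.integral_diff) (auto simp: integral_cos_diff MM.P.prob_space)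

text \<open>The lower bound on the autocorrelation is tested against
  \<open>1 - cos (y0 * t)\<close>, both of whose integrals are known.\<close>

lemma fourier_le: "C\<^sup>2 + S\<^sup>2 \<le> \<eta>"
proof -
  have "m * (\<integral>t. (1 - cos (y0 * t)) * indicator {-1..1} t \<partial>lborel)
      \<le> (\<integral>z. 1 - cos (y0 * (snd z - fst z)) \<partial>(M \<Otimes>\<^sub>M M))"
  proof (rule autocorrelation_ge)
    show "1 - cos (y0 * t) \<le> 2" for t
      using cos_ge_minus_one[of "y0 * t"] by linarith
  qed auto
  then have "m * (2 * (1 + theta0)) \<le> 1 - (C\<^sup>2 + S\<^sup>2)"
    by (simp only: integral_one_minus_cos_y0 integral_one_minus_cos_diff)
  then show ?thesis by (simp add: \<eta>_def algebra_simps)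
qed

lemma eta_nonneg: "0 \<le> \<eta>"
  using fourier_le by (smt (verit) zero_le_power2)

lemma m_le: "m \<le> 1 / (2 * (1 + theta0))" "m \<le> 1"
proof -
  have "2 * m * (1 + theta0) \<le> 1" using eta_nonneg by (simp add: \<eta>_def)
  then show *: "m \<le> 1 / (2 * (1 + theta0))" using theta0_pos by (simp add: field_simps)
  also have "\<dots> \<le> 1" using theta0_pos by (simp add: field_simps)
  finally show "m \<le> 1" .
qed

text \<open>
  The part of the autocorrelation exceeding \<^term>\<open>m\<close> on \<open>[-1,1]\<close> has small integral against
  \<open>1 - cos (y0 t)\<close>, so away from the zeros of that function it is negligible.
\<close>

lemma upper_bound:
  assumes [measurable]: "\<phi> \<in> borel_measurable borel"
    and nonneg: "\<And>t. 0 \<le> \<phi> t" and le: "\<And>t. \<phi> t \<le> K * (1 - cos (y0 * t))" and "0 \<le> K"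
  shows "(\<integral>z. \<phi> (snd z - fst z) \<partial>(M \<Otimes>\<^sub>M M))
    \<le> K * \<eta> + m * (\<integral>t. \<phi> t * indicator {-1..1} t \<partial>lborel)"
proof -
  define \<psi> where "\<psi> t = K * (1 - cos (y0 * t))" for t
  have [measurable]: "\<psi> \<in> borel_measurable borel" unfolding \<psi>_def by measurable
  have psi_nonneg: "0 \<le> \<psi> t" for t using \<open>0 \<le> K\<close> by (simp add: \<psi>_def)
  have psi_le: "\<psi> t \<le> 2 * K" for t
  proof -
    have "\<psi> t \<le> K * 2"
      unfolding \<psi>_def using \<open>0 \<le> K\<close> cos_ge_minus_one[of "y0 * t"]
      by (intro mult_left_mono) auto
    then show ?thesis by simp
  qed
  have phi_le: "\<phi> t \<le> \<psi> t" for t using le[of t] by (simp add: \<psi>_def)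
  have psi_abs: "\<bar>\<psi> t\<bar> \<le> 2 * K" for t using psi_nonneg[of t] psi_le[of t] by linarith
  have phi_abs: "\<bar>\<phi> t\<bar> \<le> 2 * K" for t
    using nonneg[of t] phi_le[of t] psi_le[of t] by linarith
  have int: "integrable lborel (\<lambda>t. f t * indicator {-1..1} t)"
    if [measurable]: "f \<in> borel_measurable borel" and bd: "\<And>t. \<bar>f t\<bar> \<le> 2 * K"
    for f :: "real \<Rightarrow> real"
  proof -
    have "set_integrable lborel {-1..1::real} (\<lambda>t. 2 * K)"
      by (intro borel_integrable_atLeastAtMost') auto
    then have "integrable lborel (\<lambda>t::real. indicator {-1..1} t * (2 * K))"
      by (simp add: set_integrable_def)
    moreover have "\<bar>f t * indicator {-1..1} t\<bar> \<le> \<bar>indicator {-1..1} t * (2 * K)\<bar>" for t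
      using bd[of t] by (simp add: indicator_def)
    ultimately show ?thesis
      by (intro Bochner_Integration.integrable_bound[where g = "\<lambda>t. f t * indicator {-1..1} t"
          and f = "\<lambda>t. indicator {-1..1} t * (2 * K)"] AE_I2) simp_all
  qed
  \<comment> \<open>Testing the complement \<open>\<psi> - \<phi>\<close> turns the lower bound for
    the autocorrelation into an upper bound for \<open>\<phi>\<close>.\<close>
  have "m * (\<integral>t. (\<psi> t - \<phi> t) * indicator {-1..1} t \<partial>lborel)
      \<le> (\<integral>z. \<psi> (snd z - fst z) - \<phi> (snd z - fst z) \<partial>(M \<Otimes>\<^sub>M M))"
  proof (rule autocorrelation_ge[where \<phi> = "\<lambda>t. \<psi> t - \<phi> t" and B = "2 * K"])
    show "(\<lambda>t. \<psi> t - \<phi> t) \<in> borel_measurable borel" by measurable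
    fix t
    show "0 \<le> \<psi> t - \<phi> t" using phi_le[of t] by simp
    show "\<psi> t - \<phi> t \<le> 2 * K" using nonneg[of t] psi_le[of t] by linarith
  qed
  also have "\<dots> = (\<integral>z. \<psi> (snd z - fst z) \<partial>(M \<Otimes>\<^sub>M M)) - (\<integral>z. \<phi> (snd z - fst z) \<partial>(M \<Otimes>\<^sub>M M))"
    by (rule Bochner_Integration.integral_diff)
      (rule integrable_diff_bounded[where B = "2 * K"], measurable, fact psi_abs phi_abs)+
  also have "(\<integral>z. \<psi> (snd z - fst z) \<partial>(M \<Otimes>\<^sub>M M)) = K * (1 - (C\<^sup>2 + S\<^sup>2))"
    by (simp add: \<psi>_def integral_one_minus_cos_diff)
  also have "(\<integral>t. (\<psi> t - \<phi> t) * indicator {-1..1} t \<partial>lborel)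
      = (\<integral>t. \<psi> t * indicator {-1..1} t \<partial>lborel) - (\<integral>t. \<phi> t * indicator {-1..1} t \<partial>lborel)"
    unfolding left_diff_distrib
    by (rule Bochner_Integration.integral_diff) (rule int, measurable, fact psi_abs phi_abs)+
  also have "(\<integral>t. \<psi> t * indicator {-1..1} t \<partial>lborel) = K * (2 * (1 + theta0))"
    by (simp only: \<psi>_def mult.assoc integral_mult_right_zero integral_one_minus_cos_y0)
  finally have "(\<integral>z. \<phi> (snd z - fst z) \<partial>(M \<Otimes>\<^sub>M M))
      \<le> K * \<eta> - K * (C\<^sup>2 + S\<^sup>2) + m * (\<integral>t. \<phi> t * indicator {-1..1} t \<partial>lborel)"
    by (simp add: \<eta>_def algebra_simps)
  moreover have "0 \<le> K * (C\<^sup>2 + S\<^sup>2)" using \<open>0 \<le> K\<close> by simp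
  ultimately show ?thesis by linarith
qed


section \<open>Clusters of mass\<close>

lemma integral_indicator_M:
  assumes "A \<in> sets borel"
  shows "(\<integral>x. indicator A x \<partial>M) = prob A"
  by (simp add: space_M)

text \<open>By Fubini, both sides are the probability that two independent points differ by an
  element of \<open>T\<close>.\<close>

lemma
  assumes [measurable]: "T \<in> sets borel"
  shows integrable_prob_translate: "integrable M (\<lambda>x. prob {y. y - x \<in> T})"
    and integral_prob_translate:
      "(\<integral>x. prob {y. y - x \<in> T} \<partial>M) = (\<integral>z. indicator T (snd z - fst z) \<partial>(M \<Otimes>\<^sub>M M))"
proof -
  have int: "integrable (M \<Otimes>\<^sub>M M) (\<lambda>z. indicator T (snd z - fst z) :: real)"
    by (rule integrable_diff_bounded[where B = 1]) simp_all
  have eq: "(\<integral>y. indicator T (snd (x, y) - fst (x, y)) \<partial>M) = prob {y. y - x \<in> T}" for x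
  proof -
    have "(\<integral>y. indicator T (snd (x, y) - fst (x, y)) \<partial>M) = (\<integral>y. indicator {y. y - x \<in> T} y \<partial>M)"
      by (simp add: indicator_def)
    also have "\<dots> = prob {y. y - x \<in> T}"
      by (rule integral_indicator_M) measurable
    finally show ?thesis .
  qed
  show "integrable M (\<lambda>x. prob {y. y - x \<in> T})"
    using MM.integrable_fst'[OF int] unfolding eq .
  show "(\<integral>x. prob {y. y - x \<in> T} \<partial>M) = (\<integral>z. indicator T (snd z - fst z) \<partial>(M \<Otimes>\<^sub>M M))"
    using MM.integral_fst'[OF int] unfolding eq .
qed

lemma near_eq: "near x r = {y. y - x \<in> {t. chord t < r}}"
  by (auto simp: near_def)

lemma integrable_prob_near: "integrable M (\<lambda>x. prob (near x r))"
  unfolding near_eq by (rule integrable_prob_translate) measurable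

text \<open>Where the chord is at least \<open>r\<close>, \<open>1 - cos (y0 * t)\<close> is at
  least \<open>r\<^sup>2 / 2\<close>, so the upper bound applies with
  \<open>K = 2 / r\<^sup>2\<close>.\<close>

lemma upper_bound_indicator:
  assumes [measurable]: "T \<in> sets borel" and far: "\<And>t. t \<in> T \<Longrightarrow> r \<le> chord t" and "0 < r"
  shows "(\<integral>z. indicator T (snd z - fst z) \<partial>(M \<Otimes>\<^sub>M M))
    \<le> 2 / r\<^sup>2 * \<eta> + m * measure lborel (T \<inter> {-1..1})"
proof -
  have "(\<integral>z. indicator T (snd z - fst z) \<partial>(M \<Otimes>\<^sub>M M))
      \<le> 2 / r\<^sup>2 * \<eta> + m * (\<integral>t. indicator T t * indicator {-1..1} t \<partial>lborel)"
  proof (rule upper_bound)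
    show "indicator T t \<le> 2 / r\<^sup>2 * (1 - cos (y0 * t))" for t
    proof (cases "t \<in> T")
      case True
      then have "r\<^sup>2 \<le> (chord t)\<^sup>2" using far \<open>0 < r\<close> by (intro power_mono) auto
      then show ?thesis using True \<open>0 < r\<close> by (simp add: chord_square field_simps)
    qed simp
  qed auto
  also have "(\<integral>t. indicator T t * indicator {-1..1} t \<partial>lborel) = measure lborel (T \<inter> {-1..1})"
    by (simp flip: indicator_inter_arith)
  finally show ?thesis .
qed

text \<open>The complementary event, a chord of at least \<open>r\<close> between two independent
  points, has probability at most \<open>2 * m\<close> plus an error, since \<open>[-1,1]\<close>
  has length 2.\<close>

lemma mean_near_ge:
  assumes "0 < r"
  shows "1 - 2 * m - 2 / r\<^sup>2 * \<eta> \<le> (\<integral>x. prob (near x r) \<partial>M)"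
proof -
  let ?T = "{t. r \<le> chord t}"
  have "measure lborel (?T \<inter> {-1..1}) \<le> measure lborel {-1..1::real}"
    by (intro measure_mono_fmeasurable) (auto intro: fmeasurable_compact)
  then have "m * measure lborel (?T \<inter> {-1..1}) \<le> m * 2"
    using m_nonneg by (intro mult_left_mono) auto
  moreover have "(\<integral>z. indicator ?T (snd z - fst z) \<partial>(M \<Otimes>\<^sub>M M))
      \<le> 2 / r\<^sup>2 * \<eta> + m * measure lborel (?T \<inter> {-1..1})"
    by (rule upper_bound_indicator[OF _ _ assms]) auto
  ultimately have "(\<integral>z. indicator ?T (snd z - fst z) \<partial>(M \<Otimes>\<^sub>M M)) \<le> 2 / r\<^sup>2 * \<eta> + 2 * m"
    by linarith
  moreover have "(\<integral>x. prob (near x r) \<partial>M)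
      = (\<integral>z. indicator {t. chord t < r} (snd z - fst z) \<partial>(M \<Otimes>\<^sub>M M))"
    unfolding near_eq by (rule integral_prob_translate) measurable
  moreover have "(\<integral>z. indicator {t. chord t < r} (snd z - fst z) \<partial>(M \<Otimes>\<^sub>M M))
      = (\<integral>z. 1 - (indicator ?T (snd z - fst z) :: real) \<partial>(M \<Otimes>\<^sub>M M))"
    by (intro Bochner_Integration.integral_cong) (auto simp: indicator_def)
  moreover have "\<dots> = 1 - (\<integral>z. indicator ?T (snd z - fst z) \<partial>(M \<Otimes>\<^sub>M M))"
    using integrable_diff_bounded[of "indicator ?T" 1]
    by (subst Bochner_Integration.integral_diff) (auto simp: MM.P.prob_space)
  ultimately show ?thesis by linarith
qed

text \<open>Two clusters at positive distance would put too much autocorrelation near that distance.\<close>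

lemma prob_near_far:
  assumes "0 < r" "3 * r \<le> chord (b - a)"
  shows "prob (near a r) * prob (near b r) \<le> 2 / r\<^sup>2 * \<eta> + 32 * r"
proof -
  \<comment> \<open>Contains all differences between points of the two clusters: they lie within
    \<open>2 * r\<close> of \<open>b - a\<close>, hence at least \<open>r\<close> away from
    0.\<close>
  let ?T = "{t. r \<le> chord t \<and> chord (t - (b - a)) < 2 * r}"
  have T: "?T \<in> sets borel" by measurable
  have "prob (near a r) * prob (near b r)
      = (\<integral>z. indicator (near a r) (fst z) * indicator (near b r) (snd z) \<partial>(M \<Otimes>\<^sub>M M))"
    by (subst integral_product) (auto simp: integral_indicator_M indicator_def)
  also have "\<dots> \<le> (\<integral>z. indicator ?T (snd z - fst z) \<partial>(M \<Otimes>\<^sub>M M))"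
  proof (rule integral_mono)
    show "integrable (M \<Otimes>\<^sub>M M) (\<lambda>z. indicator (near a r) (fst z) * indicator (near b r) (snd z) :: real)"
      by (rule integrable_product) (auto simp: indicator_def)
    show "integrable (M \<Otimes>\<^sub>M M) (\<lambda>z. indicator ?T (snd z - fst z) :: real)"
      using T by (intro integrable_diff_bounded[where B = 1]) (auto simp: indicator_def)
    fix z :: "real \<times> real"
    obtain x y where z: "z = (x, y)" by (cases z)
    have "y - x \<in> ?T" if "x \<in> near a r" "y \<in> near b r"
    proof -
      have *: "chord (y - b) < r" "chord (x - a) < r" using that by (auto simp: near_def)
      have "chord ((y - x) - (b - a)) \<le> chord (y - b) + chord (a - x)"
        using chord_add[of "y - b" "a - x"] by (simp add: algebra_simps)
      then have 1: "chord ((y - x) - (b - a)) < 2 * r"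
        using * chord_diff_commute[of a x] by simp
      have "chord (b - a) \<le> chord ((b - a) - (y - x)) + chord (y - x)"
        using chord_add[of "(b - a) - (y - x)" "y - x"] by simp
      then have "r \<le> chord (y - x)"
        using 1 assms(2) chord_diff_commute[of "b - a" "y - x"] by simp
      with 1 show ?thesis by simp
    qed
    then show "indicator (near a r) (fst z) * indicator (near b r) (snd z)
        \<le> (indicator ?T (snd z - fst z) :: real)"
      by (auto simp: z indicator_def)
  qed
  also have "\<dots> \<le> 2 / r\<^sup>2 * \<eta> + m * measure lborel (?T \<inter> {-1..1})"
    using T assms by (intro upper_bound_indicator) auto
  also have "m * measure lborel (?T \<inter> {-1..1}) \<le> 1 * (32 * r)"
  proof (intro mult_mono)
    have "measure lborel (?T \<inter> {-1..1}) \<le> measure lborel {t \<in> {-1..1}. chord (t - (b - a)) < 2 * r}"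
    proof (intro measure_mono_fmeasurable)
      show "{t \<in> {-1..1}. chord (t - (b - a)) < 2 * r} \<in> fmeasurable lborel"
        by (rule fmeasurableI2[where A = "{-1..1}"]) (auto intro: fmeasurable_compact)
    qed (use T in auto)
    also have "\<dots> \<le> 32 * r" using assms by (intro measure_chord_less) auto
    finally show "measure lborel (?T \<inter> {-1..1}) \<le> 32 * r" .
  qed (use m_le assms in auto)
  finally show ?thesis by simp
qed

text \<open>For \<open>x\<close> in \<open>near a (3 * r)\<close> the arc around \<open>x\<close>
  lies in \<open>near a (4 * r)\<close>, so both the integrand and the probability of such
  \<open>x\<close> are at most that mass; other \<open>x\<close> contribute at most
  \<open>v\<close>.\<close>

lemma mean_near_le:
  assumes "\<And>b. 3 * r \<le> chord (b - a) \<Longrightarrow> prob (near b r) \<le> v" "0 \<le> v" "0 \<le> r"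
  shows "(\<integral>x. prob (near x r) \<partial>M) \<le> (prob (near a (4 * r)))\<^sup>2 + v"
proof -
  define s where "s = prob (near a (4 * r))"
  have s: "0 \<le> s" by (simp add: s_def)
  have near_M: "near x q \<in> sets M" for x q using near_sets sets_M by simp
  have int: "integrable M (indicator (near a (3 * r)) :: real \<Rightarrow> real)"
    by (rule integrable_bounded[where B = 1]) (auto simp: indicator_def)
  have "(\<integral>x. prob (near x r) \<partial>M) \<le> (\<integral>x. s * indicator (near a (3 * r)) x + v \<partial>M)"
  proof (rule integral_mono[OF integrable_prob_near])
    show "integrable M (\<lambda>x. s * indicator (near a (3 * r)) x + v)" using int by simp
    fix x
    show "prob (near x r) \<le> s * indicator (near a (3 * r)) x + v"
    proof (cases "x \<in> near a (3 * r)")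
      case True
      have "near x r \<subseteq> near a (4 * r)"
      proof
        fix y assume "y \<in> near x r"
        then show "y \<in> near a (4 * r)"
          using True chord_triangle[of y a x] by (simp add: near_def)
      qed
      then have "prob (near x r) \<le> s"
        unfolding s_def using near_M by (intro finite_measure_mono) auto
      then show ?thesis using True assms(2) by simp
    next
      case False
      then show ?thesis using assms(1)[of x] by (simp add: near_def)
    qed
  qed
  also have "\<dots> = s * prob (near a (3 * r)) + v"
    using int by (subst Bochner_Integration.integral_add)
      (auto simp: integral_indicator_M prob_space)
  also have "prob (near a (3 * r)) \<le> s"
    unfolding s_def using assms(3) near_M by (intro finite_measure_mono) (auto simp: near_def)
  then have "s * prob (near a (3 * r)) + v \<le> s\<^sup>2 + v"
    using s by (simp add: power2_eq_square mult_left_mono)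
  finally show ?thesis by (simp add: s_def)
qed

text \<open>
  Testing the cluster \<^term>\<open>near a r\<close> against the whole measure: the Fourier coefficient at \<open>y0\<close>
  nearly vanishes, so the mass outside the cluster has to compensate for the cluster, but
  the bound \<^term>\<open>m\<close> for the autocorrelation on \<open>[-1,1]\<close> limits how much of it can lie where
  \<open>cos (y0 (y - x)) < - theta0\<close>.
\<close>

lemma cluster_inequality:
  fixes a r
  defines "s \<equiv> prob (near a r)"
  assumes "0 \<le> r"
  shows "s\<^sup>2 * (1 - 2 * r\<^sup>2)
    \<le> \<bar>C\<bar> + \<bar>S\<bar> + theta0 * s * (1 - s) + \<eta> / 2 + 2 * pi * theta0 / y0 * m"
proof -
  define w :: "real \<Rightarrow> real" where "w = indicator (near a r)"
  have w_meas [measurable]: "w \<in> borel_measurable borel" unfolding w_def by measurable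
  have w01: "w x = 0 \<or> w x = 1" for x by (auto simp: w_def indicator_def)
  have w_abs: "\<bar>w x\<bar> \<le> 1" for x using w01[of x] by auto
  have w_int: "(\<integral>x. w x \<partial>M) = s" by (simp add: w_def s_def integral_indicator_M)
  have w_integrable: "integrable M w" by (rule integrable_bounded[OF w_meas w_abs])
  define w' where "w' x = 1 - w x" for x
  have [measurable]: "w' \<in> borel_measurable borel" unfolding w'_def by measurable
  have w'_abs: "\<bar>w' x\<bar> \<le> 1" for x using w01[of x] by (auto simp: w'_def)
  have w'_int: "(\<integral>x. w' x \<partial>M) = 1 - s"
    unfolding w'_def using w_integrable w_int by (simp add: prob_space)
  define wc where "wc x = w x * cos (y0 * x)" for x
  define ws where "ws x = w x * sin (y0 * x)" for x
  have [measurable]: "wc \<in> borel_measurable borel" "ws \<in> borel_measurable borel"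
    unfolding wc_def ws_def by measurable
  have wc_abs: "\<bar>wc x\<bar> \<le> 1" and ws_abs: "\<bar>ws x\<bar> \<le> 1" for x
    using w01[of x] by (auto simp: wc_def ws_def)
  define Wc where "Wc = (\<integral>x. wc x \<partial>M)"
  define Ws where "Ws = (\<integral>x. ws x \<partial>M)"
  have W_abs: "\<bar>Wc\<bar> \<le> 1" "\<bar>Ws\<bar> \<le> 1"
  proof -
    have *: "\<bar>\<integral>x. f x \<partial>M\<bar> \<le> 1" if [measurable]: "f \<in> borel_measurable borel" and "\<And>x. \<bar>f x\<bar> \<le> 1"
      for f :: "real \<Rightarrow> real"
    proof -
      have "\<bar>\<integral>x. f x \<partial>M\<bar> \<le> (\<integral>x. \<bar>f x\<bar> \<partial>M)" by (rule integral_abs_bound)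
      also have "\<dots> \<le> 1"
        using that by (intro integral_le_const integrable_bounded[where B = 1]) auto
      finally show ?thesis .
    qed
    show "\<bar>Wc\<bar> \<le> 1" "\<bar>Ws\<bar> \<le> 1"
      unfolding Wc_def Ws_def using wc_abs ws_abs by (auto intro!: *)
  qed
  \<comment> \<open>Two points of the cluster have chord at most \<open>2 * r\<close>.\<close>
  have close: "1 - 2 * r\<^sup>2 \<le> cos (y0 * (y - x))" if "w x = 1" "w y = 1" for x y
  proof -
    have "chord (x - a) < r" "chord (y - a) < r"
      using that by (auto simp: w_def near_def indicator_def split: if_splits)
    then have "chord (y - x) \<le> 2 * r"
      using chord_triangle[of y x a] chord_diff_commute[of a x] by simp
    then have "(chord (y - x))\<^sup>2 \<le> (2 * r)\<^sup>2" using chord_nonneg by (intro power_mono) auto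
    then show ?thesis by (simp add: chord_square power_mult_distrib)
  qed
  define L where "L z = 2 * (1 - 2 * r\<^sup>2) * (w (fst z) * w (snd z))" for z
  \<comment> \<open>At a pair \<open>(x, y)\<close> this is
    \<open>(w x + w y) * cos (y0 * (y - x))\<close>, expanded into products so that its integral
    factors through \<open>C\<close> and \<open>S\<close>.\<close>
  define R1 where "R1 z = wc (fst z) * cos (y0 * snd z) + ws (fst z) * sin (y0 * snd z)
    + (cos (y0 * fst z) * wc (snd z) + sin (y0 * fst z) * ws (snd z))" for z
  define R2 where "R2 z = theta0 * (w (fst z) * w' (snd z) + w' (fst z) * w (snd z))" for z
  define R3 where "R3 z = dip (snd z - fst z)" for z :: "real \<times> real"
  \<comment> \<open>With both points in the cluster the cosine is nearly 1. With one of them,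
    \<open>cos + theta0 + dip\<close> is nonnegative. With none, only \<open>dip\<close>
    remains.\<close>
  have pointwise: "L z \<le> R1 z + R2 z + R3 z" for z
  proof -
    obtain x y where z: "z = (x, y)" by (cases z)
    have R1: "R1 z = (w x + w y) * cos (y0 * (y - x))"
      unfolding cos_diff_expand by (simp add: R1_def z wc_def ws_def algebra_simps)
    have R3: "0 \<le> R3 z" "- cos (y0 * (y - x)) - theta0 \<le> R3 z"
      by (simp_all add: R3_def z dip_def)
    show ?thesis
      using w01[of x] w01[of y] close[of x y] R3
      unfolding R1 by (auto simp: L_def R2_def w'_def z)
  qed
  have L: "integrable (M \<Otimes>\<^sub>M M) L" "(\<integral>z. L z \<partial>(M \<Otimes>\<^sub>M M)) = 2 * (1 - 2 * r\<^sup>2) * s\<^sup>2"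
    unfolding L_def using integrable_product[of w w] integral_product[of w w] w_abs
    by (simp_all add: w_int power2_eq_square)
  have R1: "integrable (M \<Otimes>\<^sub>M M) R1" "(\<integral>z. R1 z \<partial>(M \<Otimes>\<^sub>M M)) = 2 * (Wc * C + Ws * S)"
    unfolding R1_def
    using integrable_product[of wc "\<lambda>x. cos (y0 * x)"] integral_product[of wc "\<lambda>x. cos (y0 * x)"]
      integrable_product[of ws "\<lambda>x. sin (y0 * x)"] integral_product[of ws "\<lambda>x. sin (y0 * x)"]
      integrable_product[of "\<lambda>x. cos (y0 * x)" wc] integral_product[of "\<lambda>x. cos (y0 * x)" wc]
      integrable_product[of "\<lambda>x. sin (y0 * x)" ws] integral_product[of "\<lambda>x. sin (y0 * x)" ws]
      wc_abs ws_abs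
    by (simp_all add: Wc_def[symmetric] Ws_def[symmetric] C_def[symmetric] S_def[symmetric])
  have R2: "integrable (M \<Otimes>\<^sub>M M) R2" "(\<integral>z. R2 z \<partial>(M \<Otimes>\<^sub>M M)) = 2 * theta0 * s * (1 - s)"
    unfolding R2_def
    using integrable_product[of w w'] integral_product[of w w']
      integrable_product[of w' w] integral_product[of w' w] w_abs w'_abs
    by (simp_all add: w_int w'_int)
  have R3: "integrable (M \<Otimes>\<^sub>M M) R3"
    "(\<integral>z. R3 z \<partial>(M \<Otimes>\<^sub>M M)) \<le> \<eta> + m * (4 * pi * theta0 / y0)"
  proof -
    have "\<bar>dip t\<bar> \<le> 2" for t
      using dip_nonneg[of t] dip_le[of t] cos_ge_minus_one[of "y0 * t"] by linarith
    then show "integrable (M \<Otimes>\<^sub>M M) R3"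
      unfolding R3_def by (intro integrable_diff_bounded) auto
    \<comment> \<open>Here \<open>K = 1\<close>, as \<open>dip\<close> lies below
      \<open>1 - cos (y0 * t)\<close>.\<close>
    have "(\<integral>z. R3 z \<partial>(M \<Otimes>\<^sub>M M)) \<le> 1 * \<eta> + m * (\<integral>t. dip t * indicator {-1..1} t \<partial>lborel)"
      unfolding R3_def by (rule upper_bound) (simp_all add: dip_nonneg dip_le)
    also have "\<dots> \<le> 1 * \<eta> + m * (4 * pi * theta0 / y0)"
      using m_nonneg integral_dip_le by (intro add_left_mono mult_left_mono)
    finally show "(\<integral>z. R3 z \<partial>(M \<Otimes>\<^sub>M M)) \<le> \<eta> + m * (4 * pi * theta0 / y0)" by simp
  qed
  have "(\<integral>z. L z \<partial>(M \<Otimes>\<^sub>M M)) \<le> (\<integral>z. R1 z + R2 z + R3 z \<partial>(M \<Otimes>\<^sub>M M))"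
    using L R1 R2 R3 pointwise by (intro integral_mono) auto
  also have "\<dots> = 2 * (Wc * C + Ws * S) + 2 * theta0 * s * (1 - s) + (\<integral>z. R3 z \<partial>(M \<Otimes>\<^sub>M M))"
    using R1 R2 R3(1) by simp
  finally have main: "2 * (1 - 2 * r\<^sup>2) * s\<^sup>2 \<le> 2 * (Wc * C + Ws * S) + 2 * theta0 * s * (1 - s)
      + (\<eta> + m * (4 * pi * theta0 / y0))"
    using R3(2) L(2) by linarith
  have WC: "Wc * C \<le> \<bar>C\<bar>" "Ws * S \<le> \<bar>S\<bar>"
  proof -
    have "\<bar>Wc\<bar> * \<bar>C\<bar> \<le> 1 * \<bar>C\<bar>" "\<bar>Ws\<bar> * \<bar>S\<bar> \<le> 1 * \<bar>S\<bar>"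
      using W_abs by (intro mult_right_mono; simp)+
    then show "Wc * C \<le> \<bar>C\<bar>" "Ws * S \<le> \<bar>S\<bar>"
      using abs_ge_self[of "Wc * C"] abs_ge_self[of "Ws * S"] unfolding abs_mult by linarith+
  qed
  have arith: "A \<le> c + d + B + h / 2 + E"
    if "2 * A \<le> 2 * (p + q) + 2 * B + (h + 2 * E)" "p \<le> c" "q \<le> d" for A :: real and B E c d h p q
    using that by (simp add: field_simps)
  have e1: "m * (4 * pi * theta0 / y0) = 2 * (2 * pi * theta0 / y0 * m)" by simp
  have e2: "2 * (1 - 2 * r\<^sup>2) * s\<^sup>2 = 2 * (s\<^sup>2 * (1 - 2 * r\<^sup>2))" by (simp only: ac_simps)
  have e3: "2 * theta0 * s * (1 - s) = 2 * (theta0 * s * (1 - s))" by (simp only: ac_simps)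
  show ?thesis
    using arith[OF main[unfolded e1 e2 e3] WC] .
qed

text \<open>At radius \<open>\<delta>\<close>, the hypothesis on \<open>\<eta>\<close> makes the
  errors \<open>2 / \<delta>\<^sup>2 * \<eta>\<close> of order \<open>\<delta>\<^sup>2\<close>. The
  witness \<open>s\<close> is the mass of a cluster of radius \<open>4 * \<delta>\<close>: it is at
  least about \<open>c\<close>, and it satisfies the cluster inequality up to an error of order
  \<open>\<delta>\<close>.\<close>

lemma autocorrelation_cluster:
  assumes \<delta>: "0 < \<delta>" "\<delta> \<le> 1" "\<eta> \<le> \<delta> ^ 4"
    and c: "c\<^sup>2 = theta0 / (1 + theta0)" "4 * \<delta>\<^sup>2 \<le> c\<^sup>2"
  obtains s where "0 \<le> s" "s \<le> 1" "c\<^sup>2 \<le> s\<^sup>2 + (40 + 136 / c\<^sup>2) * \<delta>"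
    "(1 + theta0) * s\<^sup>2 - theta0 * s \<le> pi * theta0 / (y0 * (1 + theta0)) + (40 + 136 / c\<^sup>2) * \<delta>"
proof -
  have d2: "\<delta>\<^sup>2 \<le> \<delta>" using \<delta> by (simp add: power2_eq_square mult_left_le)
  have d4: "\<delta> ^ 4 \<le> \<delta>" using \<delta> power_le_one[of \<delta> 3] mult_left_le[of "\<delta> ^ 3" \<delta>]
    by (simp add: power_numeral_reduce)
  have c2: "0 < c\<^sup>2" using c(1) theta0_pos by simp
  have eta_d: "2 / \<delta>\<^sup>2 * \<eta> \<le> 2 * \<delta>\<^sup>2"
  proof -
    have "2 / \<delta>\<^sup>2 * \<eta> \<le> 2 / \<delta>\<^sup>2 * \<delta> ^ 4" using \<delta> by (intro mult_left_mono) auto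
    also have "\<dots> = 2 * \<delta>\<^sup>2" using \<delta> by (simp add: power_numeral_reduce power2_eq_square)
    finally show ?thesis .
  qed
  define q where "q = (\<integral>x. prob (near x \<delta>) \<partial>M)"
  have "1 - 2 * m \<ge> c\<^sup>2"
  proof -
    have "c\<^sup>2 = 1 - 2 * (1 / (2 * (1 + theta0)))" using theta0_pos by (simp add: c(1) field_simps)
    then show ?thesis using m_le(1) by linarith
  qed
  then have q: "c\<^sup>2 \<le> q + 2 * \<delta>\<^sup>2"
    using mean_near_ge[OF \<delta>(1)] eta_d unfolding q_def by linarith
  then have q_half: "c\<^sup>2 / 2 \<le> q" using c(2) by linarith
  \<comment> \<open>Not all values can lie below half of their positive mean.\<close>
  have "\<exists>a. q / 2 \<le> prob (near a \<delta>)"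
  proof (rule ccontr)
    assume "\<not> ?thesis"
    then have "q \<le> q / 2"
      unfolding q_def by (intro integral_le_const integrable_prob_near AE_I2) (auto simp: not_le intro: less_imp_le)
    then show False using q_half c2 by linarith
  qed
  then obtain a where a: "q / 2 \<le> prob (near a \<delta>)" by auto
  define s where "s = prob (near a (4 * \<delta>))"
  have s: "0 \<le> s" "s \<le> 1" by (auto simp: s_def)
  have far: "prob (near b \<delta>) \<le> 136 / c\<^sup>2 * \<delta>" if "3 * \<delta> \<le> chord (b - a)" for b
  proof -
    have "c\<^sup>2 / 4 * prob (near b \<delta>) \<le> prob (near a \<delta>) * prob (near b \<delta>)"
      using a q_half by (intro mult_right_mono) auto
    \<comment> \<open>34 is 2 from the \<open>\<eta>\<close> term plus 32 from the measure bound;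
      dividing by \<open>c\<^sup>2 / 4\<close> gives 136.\<close>
    also have "\<dots> \<le> 34 * \<delta>"
      using prob_near_far[OF \<delta>(1) that] eta_d d2 by linarith
    finally show ?thesis using c2 by (simp add: field_simps)
  qed
  have "q \<le> s\<^sup>2 + 136 / c\<^sup>2 * \<delta>"
    unfolding q_def s_def by (rule mean_near_le[OF far]) (use \<delta> in auto)
  moreover have "2 * \<delta>\<^sup>2 \<le> 40 * \<delta>" using d2 \<delta> by linarith
  ultimately have s_ge: "c\<^sup>2 \<le> s\<^sup>2 + (40 + 136 / c\<^sup>2) * \<delta>"
    using q unfolding distrib_right by linarith
  have CS: "\<bar>C\<bar> \<le> \<delta>\<^sup>2" "\<bar>S\<bar> \<le> \<delta>\<^sup>2"
  proof -
    have "C\<^sup>2 + S\<^sup>2 \<le> (\<delta>\<^sup>2)\<^sup>2" using fourier_le \<delta>(3) by simp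
    then have "\<bar>C\<bar>\<^sup>2 \<le> (\<delta>\<^sup>2)\<^sup>2" "\<bar>S\<bar>\<^sup>2 \<le> (\<delta>\<^sup>2)\<^sup>2"
      using zero_le_power2[of C] zero_le_power2[of S] by (simp_all only: power2_abs)
    then show "\<bar>C\<bar> \<le> \<delta>\<^sup>2" "\<bar>S\<bar> \<le> \<delta>\<^sup>2" by (auto intro: power2_le_imp_le)
  qed
  have "2 * pi * theta0 / y0 * m \<le> 2 * pi * theta0 / y0 * (1 / (2 * (1 + theta0)))"
    using theta0_pos y0_ge m_le by (intro mult_left_mono) auto
  also have "\<dots> = pi * theta0 / (y0 * (1 + theta0))"
    using theta0_pos y0_ge by (simp add: divide_simps)
  finally have R: "2 * pi * theta0 / y0 * m \<le> pi * theta0 / (y0 * (1 + theta0))" .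
  have s2: "s\<^sup>2 * (2 * (4 * \<delta>)\<^sup>2) \<le> 1 * (32 * \<delta>)"
  proof (rule mult_mono)
    show "s\<^sup>2 \<le> 1" using s by (simp add: power_le_one)
    show "2 * (4 * \<delta>)\<^sup>2 \<le> 32 * \<delta>" using d2 by (simp add: power_mult_distrib)
  qed auto
  have "s\<^sup>2 * (1 - 2 * (4 * \<delta>)\<^sup>2)
      \<le> \<bar>C\<bar> + \<bar>S\<bar> + theta0 * s * (1 - s) + \<eta> / 2 + 2 * pi * theta0 / y0 * m"
    unfolding s_def using \<delta> by (intro cluster_inequality) auto
  moreover have "s\<^sup>2 * (1 - 2 * (4 * \<delta>)\<^sup>2) = s\<^sup>2 - s\<^sup>2 * (2 * (4 * \<delta>)\<^sup>2)"
    by (simp only: right_diff_distrib mult_1_right)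
  moreover have "theta0 * s * (1 - s) = theta0 * s - theta0 * s\<^sup>2"
    by (simp add: power2_eq_square algebra_simps)
  moreover have "(1 + theta0) * s\<^sup>2 = s\<^sup>2 + theta0 * s\<^sup>2" by (simp add: distrib_right)
  \<comment> \<open>Lets both conclusions carry the same error term; the errors collected here are
    below \<open>40 * \<delta>\<close>.\<close>
  moreover have "0 \<le> 136 / c\<^sup>2 * \<delta>" using \<delta> by simp
  ultimately have "(1 + theta0) * s\<^sup>2 - theta0 * s
      \<le> pi * theta0 / (y0 * (1 + theta0)) + (40 * \<delta> + 136 / c\<^sup>2 * \<delta>)"
    using CS R s2 d2 d4 \<delta> by linarith
  then have "(1 + theta0) * s\<^sup>2 - theta0 * s
      \<le> pi * theta0 / (y0 * (1 + theta0)) + (40 + 136 / c\<^sup>2) * \<delta>"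
    by (simp only: distrib_right)
  with s s_ge show ?thesis by (rule that)
qed

end

section \<open>Uniform lower bound for the slack\<close>

text \<open>At \<open>s = c\<close> the quadratic
  \<open>(1 + theta0) * s\<^sup>2 - theta0 * s\<close> equals \<open>theta0 * (1 - c)\<close>, which
  exceeds the limit permitted by the cluster inequality by a fixed gap. The error terms close this
  gap only if \<open>\<delta>\<close> is not small, whatever \<open>M\<close> and \<open>m\<close>
  are.\<close>

lemma eta_lower_bound:
  "\<exists>\<delta>. 0 < \<delta> \<and> \<delta> \<le> 1 \<and>
    (\<forall>M m. large_autocorrelation M m \<longrightarrow> \<delta> ^ 4 < large_autocorrelation.\<eta> m)"
proof -
  define c where "c = sqrt (theta0 / (1 + theta0))"
  have c2: "c\<^sup>2 = theta0 / (1 + theta0)" and c0: "0 < c"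
    using theta0_pos by (auto simp: c_def)
  have "c\<^sup>2 < 1\<^sup>2" using theta0_pos by (simp add: c2)
  then have c1: "c < 1" by (rule power_less_imp_less_base) simp
  have c_theta: "(1 + theta0) * c\<^sup>2 = theta0" using theta0_pos by (simp add: c2)
  have theta_le: "theta0 \<le> (1 + theta0) * c"
  proof -
    have "theta0 = ((1 + theta0) * c) * c" using c_theta by (simp add: power2_eq_square)
    also have "\<dots> \<le> (1 + theta0) * c" using c0 c1 theta0_pos by (intro mult_left_le) auto
    finally show ?thesis .
  qed
  define R where "R = pi * theta0 / (y0 * (1 + theta0))"
  define K where "K = 40 + 136 / c\<^sup>2"
  define gap where "gap = theta0 * (1 - c) - R"
  have "theta0 * (pi / (y0 * (1 + theta0))) < theta0 * (1 - c)"
    using atom_mass_bound[of c] c2 c0 theta0_pos by (intro mult_strict_left_mono) auto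
  then have gap: "0 < gap" by (simp add: gap_def R_def mult.commute)
  have K: "0 < K" using c0 by (auto simp: K_def intro: add_pos_pos)
  \<comment> \<open>\<open>c / 2\<close> ensures
    \<open>4 * \<delta>\<^sup>2 \<le> c\<^sup>2\<close>; the last term keeps the total error
    \<open>(2 + theta0) * K * \<delta>\<close> at half the gap or less.\<close>
  define \<delta> where "\<delta> = min 1 (min (c / 2) (gap / (2 * (2 + theta0) * K)))"
  have \<delta>: "0 < \<delta>" "\<delta> \<le> 1" "\<delta> \<le> c / 2" "\<delta> \<le> gap / (2 * (2 + theta0) * K)"
    using c0 gap K theta0_pos unfolding \<delta>_def by (simp, linarith+)
  have \<delta>K: "(2 + theta0) * (K * \<delta>) < gap"
  proof -
    have "\<delta> * (2 * (2 + theta0) * K) \<le> gap"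
      using \<delta>(4) K theta0_pos by (simp add: pos_le_divide_eq)
    moreover have "0 < (2 + theta0) * (K * \<delta>)" using \<delta> K theta0_pos by simp
    ultimately show ?thesis by (simp add: algebra_simps)
  qed
  have "\<delta>\<^sup>2 \<le> (c / 2)\<^sup>2" using \<delta> by (intro power_mono) auto
  then have c\<delta>: "4 * \<delta>\<^sup>2 \<le> c\<^sup>2" by (simp add: power_divide)
  have "\<delta> ^ 4 < large_autocorrelation.\<eta> m" if "large_autocorrelation M m" for M m
  proof (rule ccontr)
    interpret large_autocorrelation M m by fact
    assume "\<not> \<delta> ^ 4 < \<eta>"
    then have "\<eta> \<le> \<delta> ^ 4" by simp
    then obtain s where s: "0 \<le> s" "s \<le> 1" "c\<^sup>2 \<le> s\<^sup>2 + K * \<delta>"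
        "(1 + theta0) * s\<^sup>2 - theta0 * s \<le> R + K * \<delta>"
      unfolding K_def R_def using autocorrelation_cluster[OF \<delta>(1,2) _ c2 c\<delta>] by metis
    have K\<delta>: "0 < K * \<delta>" "0 < theta0 * (K * \<delta>)" using K \<delta> theta0_pos by simp_all
    have gap_eq: "gap + R = theta0 - theta0 * c" by (simp add: gap_def algebra_simps)
    \<comment> \<open>For \<open>s \<ge> c\<close> the quadratic is increasing, its factor
      \<open>(1 + theta0) * s - theta0\<close> being nonnegative. For \<open>s < c\<close> the
      near-lower bound on \<open>s\<^sup>2\<close> costs an error, while \<open>- theta0 * s\<close>
      only grows.\<close>
    have "theta0 - theta0 * c \<le> (1 + theta0) * s\<^sup>2 - theta0 * s + (1 + theta0) * (K * \<delta>)"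
    proof (cases "c \<le> s")
      case True
      have "c * ((1 + theta0) * c - theta0) \<le> s * ((1 + theta0) * s - theta0)"
        using True c0 theta0_pos theta_le by (intro mult_mono) auto
      then have "(1 + theta0) * c\<^sup>2 - theta0 * c \<le> (1 + theta0) * s\<^sup>2 - theta0 * s"
        by (simp add: power2_eq_square algebra_simps)
      moreover have "0 \<le> (1 + theta0) * (K * \<delta>)" using K\<delta> theta0_pos by simp
      ultimately show ?thesis using c_theta by linarith
    next
      case False
      have "(1 + theta0) * c\<^sup>2 \<le> (1 + theta0) * (s\<^sup>2 + K * \<delta>)"
        using s(3) theta0_pos by (intro mult_left_mono) auto
      moreover have "theta0 * s \<le> theta0 * c" using False theta0_pos by (intro mult_left_mono) auto
      ultimately show ?thesis using c_theta by (simp only: distrib_left)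
    qed
    then have "gap + R \<le> R + K * \<delta> + (1 + theta0) * (K * \<delta>)"
      using s(4) gap_eq by linarith
    also have "\<dots> = R + (2 + theta0) * (K * \<delta>)" by (simp add: algebra_simps)
    finally show False using \<delta>K by linarith
  qed
  then show ?thesis using \<delta> by blast
qed

section \<open>From functions to measures\<close>

text \<open>Tonelli and the substitution \<open>y = x + t\<close> show that differences have density
  \<open>A\<close>; evenness of \<open>A\<close> carries the bound from \<open>[0,1]\<close> to
  \<open>[-1,1]\<close>.\<close>

lemma large_autocorrelation_density:
  fixes f :: "real \<Rightarrow> real"
  assumes [measurable]: "f \<in> borel_measurable borel"
    and f_nonneg: "\<And>x. 0 \<le> f x"
    and mass: "(\<integral>\<^sup>+x. f x \<partial>lborel) = 1"
    and m: "0 \<le> m"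
    and ge: "AE t in lborel. t \<in> {0..1} \<longrightarrow> ennreal m \<le> (\<integral>\<^sup>+x. ennreal (f x) * ennreal (f (x + t)) \<partial>lborel)"
  shows "large_autocorrelation (density lborel f) m"
proof -
  define M where "M = density lborel (\<lambda>x. ennreal (f x))"
  define A where "A t = (\<integral>\<^sup>+x. ennreal (f x) * ennreal (f (x + t)) \<partial>lborel)" for t
  have A_meas [measurable]: "A \<in> borel_measurable borel" unfolding A_def by measurable
  interpret prob_space M
    by (rule prob_spaceI) (simp add: M_def emeasure_density mass)
  have sets_M [measurable_cong]: "sets M = sets borel" by (simp add: M_def)
  interpret MM: pair_prob_space M M by unfold_locales
  have A_even: "A (- t) = A t" for t
  proof -
    have "A (- t) = (\<integral>\<^sup>+x. ennreal (f (t + 1 * x)) * ennreal (f (t + 1 * x + - t)) \<partial>lborel)"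
      unfolding A_def by (subst nn_integral_real_affine[where c = 1 and t = t]) auto
    also have "\<dots> = A t" unfolding A_def by (intro nn_integral_cong) (simp add: ac_simps)
    finally show ?thesis .
  qed
  have ge_sym: "AE t in lborel. t \<in> {-1..1} \<longrightarrow> ennreal m \<le> A t"
  proof -
    have pos: "AE t in lborel. t \<in> {0..1} \<longrightarrow> ennreal m \<le> A t"
      using ge by (simp only: A_def)
    \<comment> \<open>Reflection preserves null sets.\<close>
    have "AE t in lborel. 0 + (-1) * t \<in> {0..1} \<longrightarrow> ennreal m \<le> A (0 + (-1) * t)"
      by (rule AE_borel_affine[OF _ _ pos]) auto
    with pos show ?thesis
      by eventually_elim (auto simp: A_even)
  qed
  have pair: "(\<integral>\<^sup>+z. ennreal (\<phi> (snd z - fst z)) \<partial>(M \<Otimes>\<^sub>M M)) = (\<integral>\<^sup>+t. ennreal (\<phi> t) * A t \<partial>lborel)"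
    if [measurable]: "\<phi> \<in> borel_measurable borel" for \<phi> :: "real \<Rightarrow> real"
  proof -
    have "(\<integral>\<^sup>+z. ennreal (\<phi> (snd z - fst z)) \<partial>(M \<Otimes>\<^sub>M M))
        = (\<integral>\<^sup>+x. (\<integral>\<^sup>+y. ennreal (\<phi> (y - x)) \<partial>M) \<partial>M)"
      using nn_integral_fst[of "\<lambda>z. ennreal (\<phi> (snd z - fst z))" M] by simp
    also have "\<dots> = (\<integral>\<^sup>+x. ennreal (f x) * (\<integral>\<^sup>+y. ennreal (f y) * ennreal (\<phi> (y - x)) \<partial>lborel) \<partial>lborel)"
      unfolding M_def by (subst nn_integral_density, measurable)+
    also have "\<dots> = (\<integral>\<^sup>+x. ennreal (f x) * (\<integral>\<^sup>+t. ennreal (f (x + t)) * ennreal (\<phi> t) \<partial>lborel) \<partial>lborel)"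
    proof (rule nn_integral_cong)
      fix x
      have "(\<integral>\<^sup>+y. ennreal (f y) * ennreal (\<phi> (y - x)) \<partial>lborel)
          = (\<integral>\<^sup>+t. ennreal (f (x + t)) * ennreal (\<phi> t) \<partial>lborel)"
        by (subst nn_integral_real_affine[where c = 1 and t = x]) auto
      then show "ennreal (f x) * (\<integral>\<^sup>+y. ennreal (f y) * ennreal (\<phi> (y - x)) \<partial>lborel)
          = ennreal (f x) * (\<integral>\<^sup>+t. ennreal (f (x + t)) * ennreal (\<phi> t) \<partial>lborel)" by simp
    qed
    also have "\<dots> = (\<integral>\<^sup>+x. (\<integral>\<^sup>+t. ennreal (\<phi> t) * (ennreal (f x) * ennreal (f (x + t))) \<partial>lborel) \<partial>lborel)"
      by (subst nn_integral_cmult[symmetric]) (auto simp: ac_simps)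
    also have "\<dots> = (\<integral>\<^sup>+t. (\<integral>\<^sup>+x. ennreal (\<phi> t) * (ennreal (f x) * ennreal (f (x + t))) \<partial>lborel) \<partial>lborel)"
      by (rule lborel_pair.Fubini') measurable
    also have "\<dots> = (\<integral>\<^sup>+t. ennreal (\<phi> t) * A t \<partial>lborel)"
      unfolding A_def by (subst nn_integral_cmult) auto
    finally show ?thesis .
  qed
  have "large_autocorrelation M m"
  proof
    show "sets M = sets borel" by (rule sets_M)
    show "0 \<le> m" by fact
    fix \<phi> :: "real \<Rightarrow> real" and B
    assume [measurable]: "\<phi> \<in> borel_measurable borel" and \<phi>: "\<And>t. 0 \<le> \<phi> t" "\<And>t. \<phi> t \<le> B"
    have "set_integrable lborel {-1..1::real} (\<lambda>t. B)"
      by (intro borel_integrable_atLeastAtMost') auto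
    then have "integrable lborel (\<lambda>t::real. indicator {-1..1} t * B)"
      by (simp add: set_integrable_def)
    moreover have "\<phi> t \<le> \<bar>B\<bar>" for t using \<phi>(2)[of t] by linarith
    ultimately have int: "integrable lborel (\<lambda>t. m * (\<phi> t * indicator {-1..1} t))"
      using \<phi> by (intro integrable_mult_right Bochner_Integration.integrable_bound[where
            g = "\<lambda>t. \<phi> t * indicator {-1..1} t" and f = "\<lambda>t. indicator {-1..1} t * B"] AE_I2)
        (auto simp: indicator_def)
    have intP: "integrable (M \<Otimes>\<^sub>M M) (\<lambda>z. \<phi> (snd z - fst z))"
      by (rule MM.P.integrable_const_bound[where B = B]) (auto simp: \<phi>)
    have "ennreal (m * (\<integral>t. \<phi> t * indicator {-1..1} t \<partial>lborel))
        = ennreal (\<integral>t. m * (\<phi> t * indicator {-1..1} t) \<partial>lborel)" by simp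
    also have "\<dots> = (\<integral>\<^sup>+t. ennreal (m * (\<phi> t * indicator {-1..1} t)) \<partial>lborel)"
      using m \<phi> by (intro nn_integral_eq_integral[symmetric] int AE_I2) auto
    also have "\<dots> \<le> (\<integral>\<^sup>+t. ennreal (\<phi> t) * A t \<partial>lborel)"
    proof (rule nn_integral_mono_AE, use ge_sym in eventually_elim)
      fix t assume t: "t \<in> {-1..1} \<longrightarrow> ennreal m \<le> A t"
      show "ennreal (m * (\<phi> t * indicator {-1..1} t)) \<le> ennreal (\<phi> t) * A t"
      proof (cases "t \<in> {-1..1}")
        case True
        then have "ennreal (m * (\<phi> t * indicator {-1..1} t)) = ennreal (\<phi> t) * ennreal m"
          using \<phi>(1)[of t] m by (simp add: ennreal_mult mult.commute)
        also have "\<dots> \<le> ennreal (\<phi> t) * A t" using t True by (intro mult_left_mono) auto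
        finally show ?thesis .
      qed simp
    qed
    also have "\<dots> = (\<integral>\<^sup>+z. ennreal (\<phi> (snd z - fst z)) \<partial>(M \<Otimes>\<^sub>M M))"
      by (rule pair[symmetric]) measurable
    also have "\<dots> = ennreal (\<integral>z. \<phi> (snd z - fst z) \<partial>(M \<Otimes>\<^sub>M M))"
      using \<phi> by (intro nn_integral_eq_integral intP AE_I2) auto
    finally show "m * (\<integral>t. \<phi> t * indicator {-1..1} t \<partial>lborel)
        \<le> (\<integral>z. \<phi> (snd z - fst z) \<partial>(M \<Otimes>\<^sub>M M))"
      by (subst (asm) ennreal_le_iff) (auto intro!: Bochner_Integration.integral_nonneg simp: \<phi>)
  qed
  then show ?thesis by (simp add: M_def)
qed

text \<open>Equality fails when \<open>g\<close> is not integrable: the left side is then 0 by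
  default and the right side infinite.\<close>

lemma ennreal_integral_le_nn_integral:
  fixes g :: "'a \<Rightarrow> real"
  assumes "g \<in> borel_measurable M" "\<And>x. 0 \<le> g x"
  shows "ennreal (\<integral>x. g x \<partial>M) \<le> (\<integral>\<^sup>+x. g x \<partial>M)"
  using assms by (simp add: integral_eq_nn_integral ennreal_enn2real_if)

text \<open>If the bound failed, \<open>\<bar>f\<bar>\<close> divided by its norm would be the
  density of a measure with large autocorrelation. The absolute value makes the density nonnegative
  everywhere and can only raise the autocorrelation.\<close>

lemma essinf_autocorrelation_le:
  fixes f :: "real \<Rightarrow> real"
  assumes f: "integrable lborel f"
    and C: "0 \<le> C"
    and none: "\<And>M. \<not> large_autocorrelation M C"
  shows "essinf (restrict_space lborel {0..1}) (\<lambda>t. ereal (autocorrelation f t))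
    \<le> ereal (C * (L1_norm f)\<^sup>2)"
proof (rule ccontr)
  assume "\<not> ?thesis"
  then have "ereal (C * (L1_norm f)\<^sup>2)
      < Liminf (ae_filter (restrict_space lborel {0..1})) (\<lambda>t. ereal (autocorrelation f t))"
    by (simp add: essinf_def not_le)
  then have "AE t in restrict_space lborel {0..1}. C * (L1_norm f)\<^sup>2 < autocorrelation f t"
    using less_LiminfD by fastforce
  then have gt: "AE t in lborel. t \<in> {0..1} \<longrightarrow> C * (L1_norm f)\<^sup>2 < autocorrelation f t"
    by (subst (asm) AE_restrict_space_iff) auto
  note [measurable] = borel_measurable_integrable[OF f]
  define N where "N = L1_norm f"
  have N0: "0 \<le> N" by (simp add: N_def L1_norm_def)
  have N_int: "(\<integral>\<^sup>+x. \<bar>f x\<bar> \<partial>lborel) = ennreal N"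
    unfolding N_def L1_norm_def using f by (intro nn_integral_eq_integral) auto
  show False
  proof (cases "N = 0")
    \<comment> \<open>Then the autocorrelation is 0, and the strict inequality would fail on all of
      \<open>[0,1]\<close>, which is not a null set.\<close>
    case True
    then have "AE x in lborel. f x = 0"
      using N_int by (simp add: nn_integral_0_iff_AE)
    then have "AE x in lborel. f x * f (x + t) = 0" for t by eventually_elim simp
    then have zero: "autocorrelation f t = 0" for t
      unfolding autocorrelation_def by (rule integral_eq_zero_AE)
    from gt have "AE t in lborel. t \<notin> {0..1::real}"
      by eventually_elim (use True zero in \<open>auto simp: N_def\<close>)
    then have "emeasure lborel {0..1::real} = 0"
      by (subst (asm) AE_iff_measurable[where N = "{0..1}"]) auto
    then show False by simp
  next
    case False
    then have N: "0 < N" using N0 by simp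
    define F where "F x = \<bar>f x\<bar> / N" for x
    have [measurable]: "F \<in> borel_measurable borel" unfolding F_def by measurable
    have F_nonneg: "0 \<le> F x" for x using N by (simp add: F_def)
    have "large_autocorrelation (density lborel F) C"
    proof (rule large_autocorrelation_density)
      have "(\<integral>\<^sup>+x. F x \<partial>lborel) = (\<integral>\<^sup>+x. ennreal (1 / N) * ennreal \<bar>f x\<bar> \<partial>lborel)"
        using N by (intro nn_integral_cong) (simp add: F_def flip: ennreal_mult)
      also have "\<dots> = ennreal (1 / N) * ennreal N"
        by (subst nn_integral_cmult) (auto simp: N_int)
      also have "\<dots> = 1" using N by (simp flip: ennreal_mult)
      finally show "(\<integral>\<^sup>+x. F x \<partial>lborel) = 1" .
      show "AE t in lborel. t \<in> {0..1} \<longrightarrow>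
          ennreal C \<le> (\<integral>\<^sup>+x. ennreal (F x) * ennreal (F (x + t)) \<partial>lborel)"
        using gt
      proof eventually_elim
        fix t assume t: "t \<in> {0..1} \<longrightarrow> C * (L1_norm f)\<^sup>2 < autocorrelation f t"
        show "t \<in> {0..1} \<longrightarrow> ennreal C \<le> (\<integral>\<^sup>+x. ennreal (F x) * ennreal (F (x + t)) \<partial>lborel)"
        proof
          assume "t \<in> {0..1}"
          then have "C * N\<^sup>2 < autocorrelation f t" using t by (simp add: N_def)
          also have "\<dots> \<le> (\<integral>x. \<bar>f x * f (x + t)\<bar> \<partial>lborel)"
            unfolding autocorrelation_def using integral_abs_bound abs_ge_self order_trans by blast
          also have "\<dots> = (\<integral>x. N\<^sup>2 * (F x * F (x + t)) \<partial>lborel)"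
            using N by (intro Bochner_Integration.integral_cong)
              (auto simp: F_def abs_mult power2_eq_square)
          also have "\<dots> = N\<^sup>2 * (\<integral>x. F x * F (x + t) \<partial>lborel)" by simp
          finally have "C < (\<integral>x. F x * F (x + t) \<partial>lborel)" using N by (simp add: mult.commute)
          then have "ennreal C \<le> ennreal (\<integral>x. F x * F (x + t) \<partial>lborel)" by (intro ennreal_leI) simp
          also have "\<dots> \<le> (\<integral>\<^sup>+x. F x * F (x + t) \<partial>lborel)"
            by (rule ennreal_integral_le_nn_integral) (auto simp: F_nonneg)
          also have "\<dots> = (\<integral>\<^sup>+x. ennreal (F x) * ennreal (F (x + t)) \<partial>lborel)"
            by (simp add: ennreal_mult F_nonneg)
          finally show "ennreal C \<le> (\<integral>\<^sup>+x. ennreal (F x) * ennreal (F (x + t)) \<partial>lborel)" .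
        qed
      qed
    qed (use C F_nonneg in auto)
    then show False using none by blast
  qed
qed

section \<open>The least constant and the conclusion\<close>

text \<open>To evaluate \<open>LEAST\<close> the infimum of the admissible constants must be shown
  admissible; it is, since each \<open>f\<close> imposes a closed condition.\<close>

lemma best_constant_le:
  assumes "0 \<le> C" "autocorrelation_bound g I C"
  shows "best_constant g I \<le> C"
proof -
  define P where "P C \<longleftrightarrow> 0 \<le> C \<and> autocorrelation_bound g I C" for C
  define C0 where "C0 = Inf (Collect P)"
  have bdd: "bdd_below (Collect P)" by (rule bdd_belowI[of _ 0]) (auto simp: P_def)
  have ne: "Collect P \<noteq> {}" using assms by (auto simp: P_def)
  have C0: "C0 \<le> x" if "P x" for x
    unfolding C0_def using bdd that by (intro cInf_lower) auto
  have "P C0"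
    unfolding P_def autocorrelation_bound_def
  proof (intro conjI ballI)
    show "0 \<le> C0" unfolding C0_def using ne by (intro cInf_greatest) (auto simp: P_def)
    fix f assume f: "f \<in> dominated_class g I"
    define E where "E = essinf (restrict_space lborel {0..1}) (\<lambda>t. ereal (autocorrelation f t))"
    have "E \<le> ereal (C0 * (L1_norm f)\<^sup>2) + ereal e" if "0 < e" for e
    proof -
      \<comment> \<open>The summand 1 avoids dividing by zero when the norm vanishes.\<close>
      define d where "d = e / (1 + (L1_norm f)\<^sup>2)"
      have pos: "0 < 1 + (L1_norm f)\<^sup>2" by (simp add: add_pos_nonneg)
      have "0 < d" using that pos by (simp add: d_def)
      then obtain x where x: "P x" "x < C0 + d"
        using cInf_lessD[OF ne, of "C0 + d"] by (auto simp: C0_def)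
      have "E \<le> ereal (x * (L1_norm f)\<^sup>2)"
        using x(1) f by (auto simp: P_def autocorrelation_bound_def E_def)
      also have "x * (L1_norm f)\<^sup>2 \<le> (C0 + d) * (L1_norm f)\<^sup>2"
        using x by (intro mult_right_mono) auto
      also have "\<dots> = C0 * (L1_norm f)\<^sup>2 + d * (L1_norm f)\<^sup>2" by (simp add: distrib_right)
      also have "d * (L1_norm f)\<^sup>2 \<le> d * (1 + (L1_norm f)\<^sup>2)"
        using \<open>0 < d\<close> by (intro mult_left_mono) auto
      also have "d * (1 + (L1_norm f)\<^sup>2) = e" using pos by (simp add: d_def)
      finally show ?thesis by simp
    qed
    then have "E \<le> ereal (C0 * (L1_norm f)\<^sup>2)" by (rule ereal_le_epsilon2)
    then show "essinf (restrict_space lborel {0..1}) (\<lambda>t. ereal (autocorrelation f t))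
        \<le> ereal (C0 * (L1_norm f)\<^sup>2)" by (simp add: E_def)
  qed
  then have "best_constant g I = C0"
    unfolding best_constant_def using C0 by (intro Least_equality) (auto simp: P_def)
  then show ?thesis using C0[of C] assms by (simp add: P_def)
qed

theorem theorem1p7:
  fixes g :: "real \<Rightarrow> real" and I :: "real set"
  assumes "integrable lborel g"
    and "AE x in lborel. 0 \<le> g x"
    and "compact I"
  shows "best_constant g I < 1 / (2 * (1 + theta0))"
proof -
  obtain \<delta> where \<delta>: "0 < \<delta>" "\<delta> \<le> 1"
    "\<And>M m. large_autocorrelation M m \<Longrightarrow> \<delta> ^ 4 < large_autocorrelation.\<eta> m"
    using eta_lower_bound by blast
  \<comment> \<open>Chosen so that the slack for \<open>m = C\<close> is exactly
    \<open>\<delta> ^ 4\<close>, which the strict lower bound excludes.\<close>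
  define C where "C = (1 - \<delta> ^ 4) / (2 * (1 + theta0))"
  have C: "0 \<le> C" using \<delta> theta0_pos by (simp add: C_def power_le_one)
  have "\<not> large_autocorrelation M C" for M
  proof
    assume M: "large_autocorrelation M C"
    have "large_autocorrelation.\<eta> C = \<delta> ^ 4"
    proof -
      have "2 * (1 + theta0) \<noteq> 0" using theta0_pos by simp
      then have "C * (2 * (1 + theta0)) = 1 - \<delta> ^ 4"
        unfolding C_def by (rule nonzero_eq_divide_eq[THEN iffD1, OF _ refl])
      then show ?thesis
        unfolding large_autocorrelation.\<eta>_def[OF M] by (simp add: algebra_simps)
    qed
    then show False using \<delta>(3)[OF M] by simp
  qed
  then have "autocorrelation_bound g I C"
    using C unfolding autocorrelation_bound_def dominated_class_def
    by (auto intro!: essinf_autocorrelation_le)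
  then have "best_constant g I \<le> C" by (rule best_constant_le[OF C])
  also have "C < 1 / (2 * (1 + theta0))"
    using \<delta> theta0_pos by (simp add: C_def divide_strict_right_mono)
  finally show ?thesis .
qed

end
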